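(* Let $\mu\in\Delta_m$, $\nu\in\Delta_n$ have positive entries, let $C\in\mathbb R^{m\times n}$ and $\tau>0$. Denote by $(\pi^k)_k$ the primal iterates of the Sinkhorn algorithm, initialized at some $(f^0,g^0)\in\mathbb R^m\times\mathbb R^n$, applied to the entropic optimal transport problem with marginals $\mu,\nu$, cost $C$ and regularization $\tau$. Let $L$ be the number of phases, excluding the stationary final phase, of the cold Sinkhorn dynamics initialized at $(f_0[g^0],g_0[f_0[g^0]])$. Then there exist constants $T,B$ dependent only on $\mu,\nu$, and $C$ such that $$\forall k\ge T/\tau,\qquad \|X_\sharp\pi^k-\mu\|_1+\|Y_\sharp\pi^k-\nu\|_1\le B\,\sqrt\tau\,(\log 1/\tau)^{L+\frac12}.$$
   Context: $\Delta_N$ is the probability simplex in $\mathbb R^N$; $H(p|q)=\sum_I p_I\log(p_I/q_I)$ is relative entropy. The entropic optimal transport problem is to minimize $\sum_{ij}C_{ij}\pi_{ij}+\tau H(\pi|\mu\otimes\nu)$ over probability distributions $\pi$ on $\{1,\dots,m\}\times\{1,\dots,n\}$ with first marginal $\mu$ and second marginal $\nu$. **Sinkhorn algorithm.** For $\tau>0$, $f_\tau[g]_i=-\tau\log\sum_j e^{(-C_{ij}+g_j)/\tau}\nu_j$ and $g_\tau[f]_j=-\tau\log\sum_i e^{(-C_{ij}+f_i)/\tau}\mu_i$. From $(f^0,g^0)$: for $k\ge0$ even, $f^{k+1}=f_\tau[g^k]$, $g^{k+1}=g^k$; for $k$ odd, $f^{k+1}=f^k$, $g^{k+1}=g_\tau[f^k]$.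 The primal iterates are $\pi^k_{ij}=e^{(-C_{ij}+f^k_i+g^k_j)/\tau}\mu_i\nu_j$ for $k\ge1$ (these are probability distributions on $\{1,\dots,m\}\times\{1,\dots,n\}$); $\pi^0$ is given by the same formula normalized to total mass $1$. $X_\sharp\pi=(\sum_j\pi_{ij})_i$, $Y_\sharp\pi=(\sum_i\pi_{ij})_j$. **Dual OT polytope.** $\mathcal F=\{(f,g)\in\mathbb R^m\times\mathbb R^n:\ f_i+g_j\le C_{ij}\ \forall i,j\}$; $\partial\mathcal F$ is its Pareto frontier: the set of $(f,g)\in\mathcal F$ such that the only $(f',g')\in\mathcal F$ with $f'_i\ge f_i$ and $g'_j\ge g_j$ for all $i,j$ is $(f,g)$ itself. Also $f_0[g]_i=\min_j (C_{ij}-g_j)$ and $g_0[f]_j=\min_i (C_{ij}-f_i)$; always $(f_0[g],g_0[f_0[g]])\in\partial\mathcal F$. **The vectors $v^*(\mathcal E),w^*(\mathcal E)$.** For $\mathcal E\subset\{1,\dots,m\}\times\{1,\dots,n\}$, $\Delta_{\mathcal E}$ is the set of probability distributions on $\mathcal E$; for $\pi\in\Delta_{\mathcal E}$, $X_\sharp\pi,Y_\sharp\pi$ are its first and second marginals, i.e. $(X_\sharp\pi)_i=\sum_{j:(i,j)\in\mathcal E}\pi_{ij}$ and $(Y_\sharp\pi)_j=\sum_{i:(i,j)\in\mathcal E}\pi_{ij}$. If the bipartite graph on $\{1,\dots,m\}\sqcup\{1,\dots,n\}$ with edge set $\mathcal E$ has no isolated vertex, let $\mu^*(\mathcal E)$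 be the minimizer of $H(\bar\mu|\mu)$ over $\bar\mu$ such that there is $Q\in\Delta_{\mathcal E}$ with $X_\sharp Q=\bar\mu$, $Y_\sharp Q=\nu$; let $\nu^*(\mathcal E)$ be the minimizer of $H(\bar\nu|\nu)$ over $\bar\nu$ such that there is $P\in\Delta_{\mathcal E}$ with $X_\sharp P=\mu$, $Y_\sharp P=\bar\nu$; and $v^*(\mathcal E)_i=\log(\mu_i/\mu^*_i(\mathcal E))$, $w^*(\mathcal E)_j=\log(\nu_j/\nu^*_j(\mathcal E))$. **Cold Sinkhorn dynamics.** For $(\bar f^0,\bar g^0)\in\partial\mathcal F$, it is the continuous curve with $f(0)=\bar f^0$, $g(0)=\bar g^0$ and $\frac{d}{dt}f(t)=\bar v^\ell$, $\frac{d}{dt}g(t)=\bar w^\ell$ for $t\in[t_\ell,t_{\ell+1})$, $\ell\le L$, where $(t_\ell,\bar v^\ell,\bar w^\ell,\mathcal E^\ell)_{\ell\le L}$ is defined recursively: $t_0=0$, $\mathcal E^0=\{(i,j):\bar f^0_i+\bar g^0_j-C_{ij}=0\}$, $\bar v^0=v^*(\mathcal E^0)$, $\bar w^0=w^*(\mathcal E^0)$; and for $\ell\ge0$, $$t_{\ell+1}=\inf\Big\{t\ge t_\ell:\ \max_{(i,j)\notin\mathcal E^\ell} f_i(t_\ell)+g_j(t_\ell)+(t-t_\ell)(\bar v^\ell_i+\bar w^\ell_j)-C_{ij}\ge0\Big\}.$$ If $t_{\ell+1}<\infty$, then $\mathcal E^{\ell+1}=\{(i,j): f_i(t_\ell)+g_j(t_\ell)+(t_{\ell+1}-t_\ell)(\bar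 v^\ell_i+\bar w^\ell_j)-C_{ij}=0\}$, $\bar v^{\ell+1}=v^*(\mathcal E^{\ell+1})$, $\bar w^{\ell+1}=w^*(\mathcal E^{\ell+1})$. If $t_{\ell+1}=\infty$, then $L=\ell$ and the sequence stops. Set $t_{L+1}=\infty$. Each interval $[t_\ell,t_{\ell+1})$ is a phase; $[t_L,\infty)$ is the final phase, on which the dynamics is stationary. (All the sets $\mathcal E^\ell$ arising have no isolated vertex, and $L$ is finite with $L+1\le 2^{mn}$.)
   Formalization: The bound is proved for 0 < τ ≤ τ₀ with any fixed τ₀ < 1, and B may also depend on τ₀ (T does not); for τ > 1 the power of log 1/τ is undefined, and as τ → 1 the right side tends to 0 while the marginal error does not. *)

theory Defs
  imports "HOL-Analysis.Analysis"
begin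

definition prob_simplex :: "(real ^ 'a) set" where
  "prob_simplex = {p. (\<forall>i. 0 \<le> p $ i) \<and> (\<Sum>i\<in>UNIV. p $ i) = 1}"

(* The convention 0 * log (0 / q) = 0 holds automatically. *)
definition rel_entropy :: "real ^ 'a \<Rightarrow> real ^ 'a \<Rightarrow> real" where
  "rel_entropy p q = (\<Sum>i\<in>UNIV. p $ i * ln (p $ i / q $ i))"

definition X_marginal :: "real ^ 'n ^ 'm \<Rightarrow> real ^ 'm" where
  "X_marginal \<pi> = (\<chi> i. \<Sum>j\<in>UNIV. \<pi> $ i $ j)"

definition Y_marginal :: "real ^ 'n ^ 'm \<Rightarrow> real ^ 'n" where
  "Y_marginal \<pi> = (\<chi> j. \<Sum>i\<in>UNIV. \<pi> $ i $ j)"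

definition l1_norm :: "real ^ 'a \<Rightarrow> real" where
  "l1_norm x = (\<Sum>i\<in>UNIV. \<bar>x $ i\<bar>)"


section \<open>The Sinkhorn algorithm\<close>

definition f_soft :: "real ^ 'n ^ 'm \<Rightarrow> real ^ 'n \<Rightarrow> real \<Rightarrow> real ^ 'n \<Rightarrow> real ^ 'm" where
  "f_soft C \<nu> \<tau> g = (\<chi> i. - \<tau> * ln (\<Sum>j\<in>UNIV. exp ((- C $ i $ j + g $ j) / \<tau>) * \<nu> $ j))"

definition g_soft :: "real ^ 'n ^ 'm \<Rightarrow> real ^ 'm \<Rightarrow> real \<Rightarrow> real ^ 'm \<Rightarrow> real ^ 'n" where
  "g_soft C \<mu> \<tau> f = (\<chi> j. - \<tau> * ln (\<Sum>i\<in>UNIV. exp ((- C $ i $ j + f $ i) / \<tau>) * \<mu> $ i))"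

primrec sinkhorn ::
  "real ^ 'n ^ 'm \<Rightarrow> real ^ 'm \<Rightarrow> real ^ 'n \<Rightarrow> real \<Rightarrow> real ^ 'm \<Rightarrow> real ^ 'n \<Rightarrow> nat
    \<Rightarrow> (real ^ 'm) \<times> (real ^ 'n)" where
  "sinkhorn C \<mu> \<nu> \<tau> f0 g0 0 = (f0, g0)"
| "sinkhorn C \<mu> \<nu> \<tau> f0 g0 (Suc k) =
     (let (f, g) = sinkhorn C \<mu> \<nu> \<tau> f0 g0 k
      in if even k then (f_soft C \<nu> \<tau> g, g) else (f, g_soft C \<mu> \<tau> f))"

definition gibbs ::
  "real ^ 'n ^ 'm \<Rightarrow> real ^ 'm \<Rightarrow> real ^ 'n \<Rightarrow> real \<Rightarrow> real ^ 'm \<Rightarrow> real ^ 'n \<Rightarrow> real ^ 'n ^ 'm" where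
  "gibbs C \<mu> \<nu> \<tau> f g =
     (\<chi> i j. exp ((- C $ i $ j + f $ i + g $ j) / \<tau>) * \<mu> $ i * \<nu> $ j)"

definition sinkhorn_primal ::
  "real ^ 'n ^ 'm \<Rightarrow> real ^ 'm \<Rightarrow> real ^ 'n \<Rightarrow> real \<Rightarrow> real ^ 'm \<Rightarrow> real ^ 'n \<Rightarrow> nat
    \<Rightarrow> real ^ 'n ^ 'm" where
  "sinkhorn_primal C \<mu> \<nu> \<tau> f0 g0 k =
     (let (f, g) = sinkhorn C \<mu> \<nu> \<tau> f0 g0 k; \<pi> = gibbs C \<mu> \<nu> \<tau> f g
      in if k = 0 then (1 / (\<Sum>i\<in>UNIV. \<Sum>j\<in>UNIV. \<pi> $ i $ j)) *\<^sub>R \<pi> else \<pi>)"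


section \<open>The vectors \<open>v\<^sup>*\<close> and \<open>w\<^sup>*\<close>\<close>

(* Distributions on a set E of edges, extended by zero to matrices. *)
definition edge_simplex :: "('m \<times> 'n) set \<Rightarrow> (real ^ 'n ^ 'm) set" where
  "edge_simplex E =
     {\<pi>. (\<forall>i j. 0 \<le> \<pi> $ i $ j) \<and> (\<forall>i j. (i, j) \<notin> E \<longrightarrow> \<pi> $ i $ j = 0) \<and>
         (\<Sum>i\<in>UNIV. \<Sum>j\<in>UNIV. \<pi> $ i $ j) = 1}"

(* If the bipartite graph with edge set E has no isolated vertex, and mu, nu are positive,
   the minimizers below exist, are unique and have positive entries. For other E
   the values are irrelevant. *)
definition mu_star :: "real ^ 'm \<Rightarrow> real ^ 'n \<Rightarrow> ('m \<times> 'n) set \<Rightarrow> real ^ 'm" where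
  "mu_star \<mu> \<nu> E = arg_min_on (\<lambda>p. rel_entropy p \<mu>)
     {p. \<exists>Q\<in>edge_simplex E. X_marginal Q = p \<and> Y_marginal Q = \<nu>}"

definition nu_star :: "real ^ 'm \<Rightarrow> real ^ 'n \<Rightarrow> ('m \<times> 'n) set \<Rightarrow> real ^ 'n" where
  "nu_star \<mu> \<nu> E = arg_min_on (\<lambda>q. rel_entropy q \<nu>)
     {q. \<exists>P\<in>edge_simplex E. X_marginal P = \<mu> \<and> Y_marginal P = q}"

definition v_star :: "real ^ 'm \<Rightarrow> real ^ 'n \<Rightarrow> ('m \<times> 'n) set \<Rightarrow> real ^ 'm" where
  "v_star \<mu> \<nu> E = (\<chi> i. ln (\<mu> $ i / mu_star \<mu> \<nu> E $ i))"

definition w_star :: "real ^ 'm \<Rightarrow> real ^ 'n \<Rightarrow> ('m \<times> 'n) set \<Rightarrow> real ^ 'n" where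
  "w_star \<mu> \<nu> E = (\<chi> j. ln (\<nu> $ j / nu_star \<mu> \<nu> E $ j))"


section \<open>Cold Sinkhorn dynamics\<close>

definition f_hard :: "real ^ 'n ^ 'm \<Rightarrow> real ^ 'n \<Rightarrow> real ^ 'm" where
  "f_hard C g = (\<chi> i. MIN j. C $ i $ j - g $ j)"

definition g_hard :: "real ^ 'n ^ 'm \<Rightarrow> real ^ 'm \<Rightarrow> real ^ 'n" where
  "g_hard C f = (\<chi> j. MIN i. C $ i $ j - f $ i)"

definition contact_edges :: "real ^ 'n ^ 'm \<Rightarrow> real ^ 'm \<Rightarrow> real ^ 'n \<Rightarrow> ('m \<times> 'n) set" where
  "contact_edges C f g = {(i, j). f $ i + g $ j - C $ i $ j = 0}"

(* The end of the phase that starts at time t in the position (f, g). The maximum over the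
   edges outside E is a supremum in ereal, so that it is -\<infinity> when there are no such
   edges; the infimum of the empty set is \<infinity>. *)
definition phase_end ::
  "real ^ 'n ^ 'm \<Rightarrow> real ^ 'm \<Rightarrow> real ^ 'n \<Rightarrow> real \<Rightarrow> real ^ 'm \<Rightarrow> real ^ 'n \<Rightarrow> ereal" where
  "phase_end C \<mu> \<nu> t f g =
     (let E = contact_edges C f g; v = v_star \<mu> \<nu> E; w = w_star \<mu> \<nu> E
      in Inf {ereal s | s. t \<le> s \<and>
           (SUP (i, j)\<in>- E. ereal (f $ i + g $ j + (s - t) * (v $ i + w $ j) - C $ i $ j)) \<ge> 0})"

(* cold_phase C mu nu f0 g0 l is Some (t_l, f(t_l), g(t_l)) for l \<le> L and None for l > L. The
   curve is continuous with constant velocity (v, w) on each phase, so f(t_l), g(t_l) determine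
   it, and the edge set of phase l is the contact set of (f(t_l), g(t_l)). *)
primrec cold_phase ::
  "real ^ 'n ^ 'm \<Rightarrow> real ^ 'm \<Rightarrow> real ^ 'n \<Rightarrow> real ^ 'm \<Rightarrow> real ^ 'n \<Rightarrow> nat
    \<Rightarrow> (real \<times> (real ^ 'm) \<times> (real ^ 'n)) option" where
  "cold_phase C \<mu> \<nu> f0 g0 0 = Some (0, f0, g0)"
| "cold_phase C \<mu> \<nu> f0 g0 (Suc l) =
     (case cold_phase C \<mu> \<nu> f0 g0 l of
        None \<Rightarrow> None
      | Some (t, f, g) \<Rightarrow>
          (let E = contact_edges C f g; v = v_star \<mu> \<nu> E; w = w_star \<mu> \<nu> E;
               u = phase_end C \<mu> \<nu> t f g
           in if u < \<infinity>
              then let t' = real_of_ereal u in Some (t', f + (t' - t) *\<^sub>R v, g + (t' - t) *\<^sub>R w)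
              else None))"

(* The index L of the final phase, i.e. the number of phases without the final one. *)
definition cold_phases ::
  "real ^ 'n ^ 'm \<Rightarrow> real ^ 'm \<Rightarrow> real ^ 'n \<Rightarrow> real ^ 'm \<Rightarrow> real ^ 'n \<Rightarrow> nat" where
  "cold_phases C \<mu> \<nu> f0 g0 = (LEAST l. cold_phase C \<mu> \<nu> f0 g0 (Suc l) = None)"

end

theory Submission
  imports Defs
begin

text \<open>
  Two facts of different nature are combined.

  The first concerns the algorithm: after \<open>T / \<tau>\<close> iterations the marginal error is at most
  \<open>A * sqrt \<tau>\<close>, with \<open>T\<close> and \<open>A\<close> depending on \<open>\<mu>\<close>, \<open>\<nu>\<close>, \<open>C\<close> alone
  (\<open>sinkhorn_marginal_error\<close>). Along the iterates the error \<open>e\<close> does not increase, and each iteration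
  raises the dual value \<open>f \<bullet> \<mu> + g \<bullet> \<nu>\<close> by \<open>\<tau>\<close> times a relative entropy, hence by at least
  \<open>\<tau> * e^2 / 4\<close> (a weak form of Pinsker's inequality). The dual value stays within a bounded distance
  of its value after two iterations, whatever the starting point, so \<open>e\<close> is below any fixed
  \<open>\<eta>\<close> after \<open>O(1 / \<tau>)\<close> iterations. Once \<open>e\<close> is below a suitable \<open>\<eta>\<close>, compactness provides an
  exact coupling \<open>P\<close> of \<open>\<mu>\<close> and \<open>\<nu>\<close> supported where the iterate has mass at least \<open>\<eta>\<close>
  (\<open>near_couplings_dominate_a_coupling\<close>). There \<open>f + g - C\<close> is at least \<open>\<tau> * ln \<eta>\<close>, while for all
  later iterates it is at most a constant times \<open>\<tau>\<close>; integrating against \<open>P\<close>, the dual value can only grow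
  by \<open>O(\<tau>)\<close> from then on. If it grows by \<open>\<tau> * e^2 / 4\<close> in each of \<open>1 / \<tau>\<close> further iterations,
  then \<open>e^2\<close> is \<open>O(\<tau>)\<close>.

  The second fact is that the number \<open>L\<close> of phases of the cold dynamics is bounded uniformly in
  the starting point (\<open>cold_phases_le\<close>). It turns a bound without logarithms into the stated one:
  \<open>ln (1 / \<tau>)\<close> is bounded below by \<open>ln (1 / \<tau>\<^sub>0) > 0\<close>, which may be less than \<open>1\<close>, so its powers
  are bounded below only as long as the exponents are bounded above. The bound on \<open>L\<close> holds because
  the edge sets of the phases are pairwise distinct: the minimal relative entropy that defines
  \<open>\<mu>\<^sup>*\<close> decreases strictly from one phase to the next. Indeed an optimal plan for the old edge set
  is still supported on the new one, but an edge that has just become tight has \<open>v i + w j > 0\<close>, and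
  moving mass onto it lowers the entropy.
\<close>

section \<open>Relative entropy\<close>

text \<open>The inequality is \<open>ln z \<le> z - 1\<close> at \<open>z = sqrt (y / x)\<close>. The summand \<open>x - y\<close> cancels when
  two probability vectors are summed over, which leaves the squared Hellinger distance.\<close>

lemma entropy_term_ge_hellinger:
  fixes x y :: real
  assumes "0 \<le> x" "0 < y"
  shows "(sqrt x - sqrt y)\<^sup>2 + (x - y) \<le> x * ln (x / y)"
proof (cases "x = 0")
  case True
  then show ?thesis using assms by simp
next
  case False
  define a b where "a = sqrt x" and "b = sqrt y"
  have ab: "0 < a" "0 < b" "x = a\<^sup>2" "y = b\<^sup>2"
    using assms False by (auto simp: a_def b_def)
  have "ln (x / y) = - 2 * ln (b / a)"
    using ab by (simp add: ln_div ln_realpow)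
  moreover have "ln (b / a) \<le> b / a - 1"
    using ab by (intro ln_le_minus_one) simp
  ultimately have "x * (2 - 2 * (b / a)) \<le> x * ln (x / y)"
    using assms(1) by (intro mult_left_mono) auto
  also have "x * (2 - 2 * (b / a)) = (a - b)\<^sup>2 + (x - y)"
    using ab by (simp add: field_simps power2_eq_square)
  finally show ?thesis by (simp add: a_def b_def)
qed

lemma entropy_term_ge_diff:
  fixes x y :: real
  assumes "0 \<le> x" "0 < y"
  shows "x - y \<le> x * ln (x / y)"
  using entropy_term_ge_hellinger[OF assms] zero_le_power2[of "sqrt x - sqrt y"] by linarith

text \<open>Pinsker's inequality up to the constant. The factorization
  \<open>p - q = (sqrt p - sqrt q) * (sqrt p + sqrt q)\<close> and the Cauchy-Schwarz inequality reduce it to the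
  Hellinger bound.\<close>

lemma rel_entropy_ge_l1_norm:
  fixes p q :: "real ^ 'a"
  assumes "p \<in> prob_simplex" "q \<in> prob_simplex" and q: "\<forall>i. 0 < q $ i"
  shows "(l1_norm (p - q))\<^sup>2 \<le> 4 * rel_entropy p q"
proof -
  define s d where "s = (\<lambda>i. sqrt (p $ i) + sqrt (q $ i))" and "d = (\<lambda>i. \<bar>sqrt (p $ i) - sqrt (q $ i)\<bar>)"
  have p: "0 \<le> p $ i" for i using assms(1) by (simp add: prob_simplex_def)
  have sum1: "(\<Sum>i\<in>UNIV. p $ i) = 1" "(\<Sum>i\<in>UNIV. q $ i) = 1"
    using assms(1,2) by (auto simp: prob_simplex_def)
  have "\<bar>(p - q) $ i\<bar> = d i * s i" for i
  proof -
    have "p $ i - q $ i = (sqrt (p $ i) - sqrt (q $ i)) * s i"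
      using p[of i] q[rule_format, of i]
      by (simp add: s_def algebra_simps flip: power2_eq_square)
    moreover have "0 \<le> s i" using p[of i] q[rule_format, of i] by (simp add: s_def)
    ultimately show ?thesis by (simp add: abs_mult d_def)
  qed
  then have "(l1_norm (p - q))\<^sup>2 = (\<Sum>i\<in>UNIV. d i * s i)\<^sup>2"
    unfolding l1_norm_def by simp
  also have "\<dots> \<le> (\<Sum>i\<in>UNIV. (d i)\<^sup>2) * (\<Sum>i\<in>UNIV. (s i)\<^sup>2)"
    by (rule Cauchy_Schwarz_ineq_sum)
  also have "\<dots> \<le> rel_entropy p q * 4"
  proof (rule mult_mono)
    have "(\<Sum>i\<in>UNIV. (d i)\<^sup>2) = (\<Sum>i\<in>UNIV. (d i)\<^sup>2 + (p $ i - q $ i))"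
      by (simp add: sum.distrib sum_subtractf sum1)
    also have "\<dots> \<le> rel_entropy p q"
      unfolding rel_entropy_def d_def
      using entropy_term_ge_hellinger p q by (intro sum_mono) simp
    finally show "(\<Sum>i\<in>UNIV. (d i)\<^sup>2) \<le> rel_entropy p q" .
    then show "0 \<le> rel_entropy p q" by (rule order_trans[rotated]) (simp add: sum_nonneg)
    have "(s i)\<^sup>2 \<le> 2 * p $ i + 2 * q $ i" for i
      using p[of i] q[rule_format, of i] sum_squares_bound[of "sqrt (p $ i)" "sqrt (q $ i)"]
      by (simp add: s_def power2_sum)
    then have "(\<Sum>i\<in>UNIV. (s i)\<^sup>2) \<le> (\<Sum>i\<in>UNIV. 2 * p $ i + 2 * q $ i)"
      by (intro sum_mono) simp
    also have "\<dots> = 4" by (simp add: sum.distrib sum1 flip: sum_distrib_left)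
    finally show "(\<Sum>i\<in>UNIV. (s i)\<^sup>2) \<le> 4" .
  qed (simp add: sum_nonneg)
  finally show ?thesis by simp
qed

section \<open>One half-step of the Sinkhorn algorithm\<close>

definition marginal_error :: "real ^ 'm \<Rightarrow> real ^ 'n \<Rightarrow> real ^ 'n ^ 'm \<Rightarrow> real" where
  "marginal_error \<mu> \<nu> \<pi> = l1_norm (X_marginal \<pi> - \<mu>) + l1_norm (Y_marginal \<pi> - \<nu>)"

lemma l1_norm_nonneg: "0 \<le> l1_norm x"
  by (simp add: l1_norm_def sum_nonneg)

lemma X_marginal_transpose: "X_marginal (transpose \<pi>) = Y_marginal \<pi>"
  and Y_marginal_transpose: "Y_marginal (transpose \<pi>) = X_marginal \<pi>"
  by (simp_all add: X_marginal_def Y_marginal_def transpose_def)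

lemma sum_X_marginal: "(\<Sum>i\<in>UNIV. X_marginal \<pi> $ i) = (\<Sum>i\<in>UNIV. \<Sum>j\<in>UNIV. \<pi> $ i $ j)"
  by (simp add: X_marginal_def)

lemma sum_Y_marginal: "(\<Sum>j\<in>UNIV. Y_marginal \<pi> $ j) = (\<Sum>i\<in>UNIV. \<Sum>j\<in>UNIV. \<pi> $ i $ j)"
  unfolding Y_marginal_def by (simp add: sum.swap[of "\<lambda>i j. \<pi> $ i $ j"])

lemma gibbs_transpose: "gibbs (transpose C) \<nu> \<mu> \<tau> g f = transpose (gibbs C \<mu> \<nu> \<tau> f g)"
  by (simp add: gibbs_def transpose_def vec_eq_iff algebra_simps)

lemma g_soft_eq_f_soft: "g_soft C \<mu> \<tau> f = f_soft (transpose C) \<mu> \<tau> f"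
  by (simp add: g_soft_def f_soft_def transpose_def)

lemma gibbs_pos:
  assumes "\<forall>i. 0 < \<mu> $ i" "\<forall>j. 0 < \<nu> $ j"
  shows "0 < gibbs C \<mu> \<nu> \<tau> f g $ i $ j"
  using assms by (simp add: gibbs_def)

text \<open>This formula carries all properties of a half-step: the density of the first marginal with
  respect to \<open>\<mu>\<close> measures how far \<open>f\<close> is from its update.\<close>

lemma X_marginal_gibbs:
  assumes "0 < \<tau>" "\<forall>j. 0 < \<nu> $ j"
  shows "X_marginal (gibbs C \<mu> \<nu> \<tau> f g) $ i = \<mu> $ i * exp ((f $ i - f_soft C \<nu> \<tau> g $ i) / \<tau>)"
proof -
  define Z where "Z = (\<Sum>j\<in>UNIV. exp ((- C $ i $ j + g $ j) / \<tau>) * \<nu> $ j)"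
  have "0 < Z" unfolding Z_def using assms(2) by (intro sum_pos) auto
  have "f_soft C \<nu> \<tau> g $ i = - \<tau> * ln Z" by (simp add: f_soft_def Z_def)
  then have "(f $ i - f_soft C \<nu> \<tau> g $ i) / \<tau> = f $ i / \<tau> + ln Z"
    using assms(1) by (simp add: field_simps)
  then have "\<mu> $ i * exp ((f $ i - f_soft C \<nu> \<tau> g $ i) / \<tau>) = \<mu> $ i * exp (f $ i / \<tau>) * Z"
    using \<open>0 < Z\<close> by (simp add: exp_add)
  also have "\<dots> = (\<Sum>j\<in>UNIV. exp ((- C $ i $ j + f $ i + g $ j) / \<tau>) * \<mu> $ i * \<nu> $ j)"
    unfolding Z_def sum_distrib_left
    by (intro sum.cong refl) (simp add: add_divide_distrib diff_divide_distrib exp_add exp_diff)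
  finally show ?thesis by (simp add: X_marginal_def gibbs_def)
qed

lemma X_marginal_f_soft:
  assumes "0 < \<tau>" "\<forall>j. 0 < \<nu> $ j"
  shows "X_marginal (gibbs C \<mu> \<nu> \<tau> (f_soft C \<nu> \<tau> g) g) = \<mu>"
  by (simp add: vec_eq_iff X_marginal_gibbs[OF assms])

lemma Y_marginal_g_soft:
  assumes "0 < \<tau>" "\<forall>i. 0 < \<mu> $ i"
  shows "Y_marginal (gibbs C \<mu> \<nu> \<tau> f (g_soft C \<mu> \<tau> f)) = \<nu>"
  using X_marginal_f_soft[OF assms, of "transpose C" \<nu> f]
  by (simp add: gibbs_transpose X_marginal_transpose g_soft_eq_f_soft)

text \<open>The update multiplies row \<open>i\<close> of the plan by \<open>\<mu> i / x i\<close>, where \<open>x\<close> is the first marginal.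
  The error thereby passes from the first marginal to the second, and the triangle inequality over
  the rows shows that it does not grow. The gain of the dual value is exactly \<open>\<tau>\<close> times the relative
  entropy of \<open>\<mu>\<close> with respect to \<open>x\<close>.\<close>

lemma f_soft_step:
  fixes \<mu> :: "real ^ 'm" and \<nu> :: "real ^ 'n"
  assumes \<tau>: "0 < \<tau>" and \<mu>: "\<mu> \<in> prob_simplex" "\<forall>i. 0 < \<mu> $ i"
    and \<nu>: "\<nu> \<in> prob_simplex" "\<forall>j. 0 < \<nu> $ j"
    and Y: "Y_marginal (gibbs C \<mu> \<nu> \<tau> f g) = \<nu>"
  defines "f' \<equiv> f_soft C \<nu> \<tau> g"
  shows "marginal_error \<mu> \<nu> (gibbs C \<mu> \<nu> \<tau> f' g) \<le> marginal_error \<mu> \<nu> (gibbs C \<mu> \<nu> \<tau> f g)"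
    and "f \<bullet> \<mu> + \<tau> / 4 * (marginal_error \<mu> \<nu> (gibbs C \<mu> \<nu> \<tau> f g))\<^sup>2 \<le> f' \<bullet> \<mu>"
proof -
  define \<pi> \<pi>' x where "\<pi> = gibbs C \<mu> \<nu> \<tau> f g" and "\<pi>' = gibbs C \<mu> \<nu> \<tau> f' g" and "x = X_marginal \<pi>"
  have x: "x $ i = \<mu> $ i * exp ((f $ i - f' $ i) / \<tau>)" for i
    unfolding x_def \<pi>_def f'_def by (rule X_marginal_gibbs[OF \<tau> \<nu>(2)])
  have xpos: "\<forall>i. 0 < x $ i" using \<mu> by (simp add: x)
  have "(\<Sum>i\<in>UNIV. x $ i) = 1"
    using \<nu>(1) Y by (simp add: x_def sum_X_marginal flip: sum_Y_marginal) (simp add: \<pi>_def prob_simplex_def)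
  then have xs: "x \<in> prob_simplex" using xpos by (simp add: prob_simplex_def less_imp_le)
  have err: "marginal_error \<mu> \<nu> \<pi> = l1_norm (\<mu> - x)"
    using Y by (simp add: marginal_error_def \<pi>_def x_def l1_norm_def abs_minus_commute)
  have X': "X_marginal \<pi>' = \<mu>"
    unfolding \<pi>'_def f'_def by (rule X_marginal_f_soft[OF \<tau> \<nu>(2)])
  have \<pi>': "\<pi>' $ i $ j = \<pi> $ i $ j * (\<mu> $ i / x $ i)" for i j
  proof -
    have "(- C $ i $ j + f' $ i + g $ j) / \<tau> = (- C $ i $ j + f $ i + g $ j) / \<tau> - (f $ i - f' $ i) / \<tau>"
      by (simp add: diff_divide_distrib add_divide_distrib)
    moreover have "\<mu> $ i / x $ i = 1 / exp ((f $ i - f' $ i) / \<tau>)"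
      using \<mu>(2)[rule_format, of i] by (simp add: x)
    ultimately show ?thesis unfolding \<pi>_def \<pi>'_def gibbs_def by (simp add: exp_diff)
  qed
  have \<pi>_pos: "0 < \<pi> $ i $ j" for i j
    unfolding \<pi>_def by (rule gibbs_pos[OF \<mu>(2) \<nu>(2)])
  have "marginal_error \<mu> \<nu> \<pi>' = (\<Sum>j\<in>UNIV. \<bar>Y_marginal \<pi>' $ j - Y_marginal \<pi> $ j\<bar>)"
    using X' Y by (simp add: marginal_error_def \<pi>_def l1_norm_def)
  also have "\<dots> = (\<Sum>j\<in>UNIV. \<bar>\<Sum>i\<in>UNIV. \<pi> $ i $ j * (\<mu> $ i / x $ i - 1)\<bar>)"
    by (simp add: Y_marginal_def \<pi>' algebra_simps flip: sum_subtractf)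
  also have "\<dots> \<le> (\<Sum>j\<in>UNIV. \<Sum>i\<in>UNIV. \<bar>\<pi> $ i $ j * (\<mu> $ i / x $ i - 1)\<bar>)"
    by (intro sum_mono sum_abs)
  also have "\<dots> = (\<Sum>i\<in>UNIV. \<Sum>j\<in>UNIV. \<pi> $ i $ j * \<bar>\<mu> $ i / x $ i - 1\<bar>)"
    by (subst sum.swap) (simp add: abs_mult abs_of_pos[OF \<pi>_pos])
  also have "\<dots> = (\<Sum>i\<in>UNIV. x $ i * \<bar>\<mu> $ i / x $ i - 1\<bar>)"
    by (simp add: x_def X_marginal_def sum_distrib_right)
  also have "\<dots> = (\<Sum>i\<in>UNIV. \<bar>\<mu> $ i - x $ i\<bar>)"
  proof (intro sum.cong refl)
    fix i
    have "x $ i * \<bar>\<mu> $ i / x $ i - 1\<bar> = \<bar>x $ i * (\<mu> $ i / x $ i - 1)\<bar>"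
      using xpos by (simp add: abs_mult abs_of_pos)
    also have "x $ i * (\<mu> $ i / x $ i - 1) = \<mu> $ i - x $ i"
      using xpos[rule_format, of i] by (simp add: field_simps)
    finally show "x $ i * \<bar>\<mu> $ i / x $ i - 1\<bar> = \<bar>\<mu> $ i - x $ i\<bar>" .
  qed
  also have "\<dots> = marginal_error \<mu> \<nu> \<pi>" by (simp add: err l1_norm_def)
  finally show "marginal_error \<mu> \<nu> (gibbs C \<mu> \<nu> \<tau> f' g) \<le> marginal_error \<mu> \<nu> (gibbs C \<mu> \<nu> \<tau> f g)"
    by (simp add: \<pi>_def \<pi>'_def)
  have "\<tau> * rel_entropy \<mu> x = f' \<bullet> \<mu> - f \<bullet> \<mu>"
  proof -
    have "\<tau> * (\<mu> $ i * ln (\<mu> $ i / x $ i)) = (f' $ i - f $ i) * \<mu> $ i" for i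
    proof -
      have "\<mu> $ i / x $ i = exp ((f' $ i - f $ i) / \<tau>)"
        using \<mu>(2)[rule_format, of i] by (simp add: x exp_diff diff_divide_distrib)
      then show ?thesis using \<tau> by simp
    qed
    then show ?thesis
      unfolding rel_entropy_def sum_distrib_left inner_vec_def
      by (simp add: left_diff_distrib sum_subtractf)
  qed
  moreover have "\<tau> / 4 * (l1_norm (\<mu> - x))\<^sup>2 \<le> \<tau> * rel_entropy \<mu> x"
    using rel_entropy_ge_l1_norm[OF \<mu>(1) xs xpos] \<tau> by simp
  ultimately show "f \<bullet> \<mu> + \<tau> / 4 * (marginal_error \<mu> \<nu> (gibbs C \<mu> \<nu> \<tau> f g))\<^sup>2 \<le> f' \<bullet> \<mu>"
    using err by (simp add: \<pi>_def)
qed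

lemma marginal_error_transpose: "marginal_error \<nu> \<mu> (transpose \<pi>) = marginal_error \<mu> \<nu> \<pi>"
  by (simp add: marginal_error_def X_marginal_transpose Y_marginal_transpose)

lemma g_soft_step:
  fixes \<mu> :: "real ^ 'm" and \<nu> :: "real ^ 'n"
  assumes "0 < \<tau>" "\<mu> \<in> prob_simplex" "\<forall>i. 0 < \<mu> $ i" "\<nu> \<in> prob_simplex" "\<forall>j. 0 < \<nu> $ j"
    and "X_marginal (gibbs C \<mu> \<nu> \<tau> f g) = \<mu>"
  defines "g' \<equiv> g_soft C \<mu> \<tau> f"
  shows "marginal_error \<mu> \<nu> (gibbs C \<mu> \<nu> \<tau> f g') \<le> marginal_error \<mu> \<nu> (gibbs C \<mu> \<nu> \<tau> f g)"
    and "g \<bullet> \<nu> + \<tau> / 4 * (marginal_error \<mu> \<nu> (gibbs C \<mu> \<nu> \<tau> f g))\<^sup>2 \<le> g' \<bullet> \<nu>"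
  using f_soft_step[of \<tau> \<nu> \<mu> "transpose C" g f] assms
  by (simp_all add: gibbs_transpose Y_marginal_transpose marginal_error_transpose g_soft_eq_f_soft)

section \<open>Convergence of the Sinkhorn iterates\<close>

lemma bounded_matrix_entries:
  fixes S :: "(real ^ 'n ^ 'm) set"
  assumes "\<And>Q i j. Q \<in> S \<Longrightarrow> \<bar>Q $ i $ j\<bar> \<le> M"
  shows "bounded S"
proof -
  have "norm Q \<le> (\<Sum>i\<in>(UNIV::'m set). \<Sum>j\<in>(UNIV::'n set). M)" if "Q \<in> S" for Q
  proof -
    have "norm Q \<le> (\<Sum>i\<in>UNIV. norm (Q $ i))"
      unfolding norm_vec_def by (rule L2_set_le_sum) simp
    also have "\<dots> \<le> (\<Sum>i\<in>UNIV. \<Sum>j\<in>UNIV. \<bar>Q $ i $ j\<bar>)"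
      by (intro sum_mono norm_le_l1_cart)
    also have "\<dots> \<le> (\<Sum>i\<in>(UNIV::'m set). \<Sum>j\<in>(UNIV::'n set). M)"
      using assms[OF that] by (intro sum_mono)
    finally show ?thesis .
  qed
  then show ?thesis unfolding bounded_iff by blast
qed

text \<open>compactness\<close>

text \<open>If no \<open>\<eta>\<close> worked, there would be counterexamples \<open>\<pi> k\<close> for \<open>\<eta> = 1 / (k + 1)\<close>. A limit
  point of them is an exact coupling, and on its finite support the entries of \<open>\<pi> k\<close> are eventually
  bounded away from \<open>0\<close>. So the limit point itself is an admissible choice of \<open>P\<close>.\<close>

lemma near_couplings_dominate_a_coupling:
  fixes \<mu> :: "real ^ 'm" and \<nu> :: "real ^ 'n"
  obtains \<eta> where "0 < \<eta>" "\<eta> \<le> 1"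
    "\<And>\<pi>. \<forall>i j. 0 \<le> \<pi> $ i $ j \<Longrightarrow> marginal_error \<mu> \<nu> \<pi> \<le> \<eta> \<Longrightarrow>
      \<exists>P. (\<forall>i j. 0 \<le> P $ i $ j) \<and> X_marginal P = \<mu> \<and> Y_marginal P = \<nu> \<and>
          (\<forall>i j. 0 < P $ i $ j \<longrightarrow> \<eta> \<le> \<pi> $ i $ j)"
proof -
  define good :: "real \<Rightarrow> real ^ 'n ^ 'm \<Rightarrow> bool" where "good = (\<lambda>\<eta> \<pi>. \<exists>P. (\<forall>i j. 0 \<le> P $ i $ j) \<and> X_marginal P = \<mu> \<and> Y_marginal P = \<nu> \<and>
          (\<forall>i j. 0 < P $ i $ j \<longrightarrow> \<eta> \<le> \<pi> $ i $ j))"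
  have "\<exists>\<eta>. 0 < \<eta> \<and> \<eta> \<le> 1 \<and> (\<forall>\<pi>. (\<forall>i j. 0 \<le> \<pi> $ i $ j) \<longrightarrow> marginal_error \<mu> \<nu> \<pi> \<le> \<eta> \<longrightarrow> good \<eta> \<pi>)"
  proof (rule ccontr)
    assume contra: "\<not> ?thesis"
    have "\<exists>\<pi>. (\<forall>i j. 0 \<le> \<pi> $ i $ j) \<and> marginal_error \<mu> \<nu> \<pi> \<le> inverse (real (Suc k)) \<and> \<not> good (inverse (real (Suc k))) \<pi>" for k
    proof -
      have "0 < inverse (real (Suc k))" "inverse (real (Suc k)) \<le> 1" by (simp_all add: inverse_le_1_iff)
      then show ?thesis using contra by blast
    qed
    then obtain \<pi> :: "nat \<Rightarrow> real ^ 'n ^ 'm" where pos: "\<And>k i j. 0 \<le> \<pi> k $ i $ j"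
      and err: "\<And>k. marginal_error \<mu> \<nu> (\<pi> k) \<le> inverse (real (Suc k))"
      and bad: "\<And>k. \<not> good (inverse (real (Suc k))) (\<pi> k)" by metis
    define M where "M = 1 + (\<Sum>i\<in>UNIV. \<bar>\<mu> $ i\<bar>)"
    have entry: "\<pi> k $ i $ j \<le> M" for k i j
    proof -
      have "\<pi> k $ i $ j \<le> X_marginal (\<pi> k) $ i"
        unfolding X_marginal_def using pos by (simp add: member_le_sum)
      also have "\<dots> \<le> \<bar>\<mu> $ i\<bar> + \<bar>(X_marginal (\<pi> k) - \<mu>) $ i\<bar>" by simp
      also have "\<bar>(X_marginal (\<pi> k) - \<mu>) $ i\<bar> \<le> l1_norm (X_marginal (\<pi> k) - \<mu>)"
        unfolding l1_norm_def by (rule member_le_sum) auto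
      also have "\<dots> \<le> 1"
        using err[of k] l1_norm_nonneg[of "Y_marginal (\<pi> k) - \<nu>"]
          inverse_le_1_iff[of "real (Suc k)"] by (simp add: marginal_error_def)
      also have "\<bar>\<mu> $ i\<bar> \<le> (\<Sum>i\<in>UNIV. \<bar>\<mu> $ i\<bar>)" by (rule member_le_sum) auto
      finally show ?thesis by (simp add: M_def)
    qed
    have "bounded (range \<pi>)"
      using entry pos by (intro bounded_matrix_entries[of _ M]) auto
    then obtain P r where r: "strict_mono r" and lim: "(\<pi> \<circ> r) \<longlonglongrightarrow> P"
      using bounded_imp_convergent_subsequence by blast
    have lim_entry: "(\<lambda>k. \<pi> (r k) $ i $ j) \<longlonglongrightarrow> P $ i $ j" for i j
      using tendsto_vec_nth[OF tendsto_vec_nth[OF lim]] by (simp add: o_def)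
    have Ppos: "0 \<le> P $ i $ j" for i j
      using LIMSEQ_le_const[OF lim_entry] pos by blast
    have inv0: "(\<lambda>k. inverse (real (Suc (r k)))) \<longlonglongrightarrow> 0"
      using LIMSEQ_subseq_LIMSEQ[OF LIMSEQ_inverse_real_of_nat r] by (simp add: o_def)
    have "(\<lambda>k. marginal_error \<mu> \<nu> (\<pi> (r k))) \<longlonglongrightarrow> marginal_error \<mu> \<nu> P"
      unfolding marginal_error_def l1_norm_def X_marginal_def Y_marginal_def
      by (auto intro!: tendsto_intros lim_entry)
    then have "marginal_error \<mu> \<nu> P \<le> 0"
      using LIMSEQ_le[OF _ inv0] err by blast
    then have "l1_norm (X_marginal P - \<mu>) = 0" "l1_norm (Y_marginal P - \<nu>) = 0"
      using l1_norm_nonneg[of "X_marginal P - \<mu>"] l1_norm_nonneg[of "Y_marginal P - \<nu>"]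
      by (simp_all add: marginal_error_def)
    then have marg: "X_marginal P = \<mu>" "Y_marginal P = \<nu>"
      by (simp_all add: l1_norm_def sum_nonneg_eq_0_iff vec_eq_iff)
    have "\<forall>\<^sub>F k in sequentially. 0 < P $ i $ j \<longrightarrow> inverse (real (Suc (r k))) \<le> \<pi> (r k) $ i $ j" for i j
    proof (cases "0 < P $ i $ j")
      case True
      then have "\<forall>\<^sub>F k in sequentially. 0 < \<pi> (r k) $ i $ j - inverse (real (Suc (r k)))"
        using tendsto_diff[OF lim_entry inv0] by (intro order_tendstoD) auto
      then show ?thesis by (rule eventually_mono) simp
    qed simp
    then have "\<forall>\<^sub>F k in sequentially. \<forall>i j. 0 < P $ i $ j \<longrightarrow> inverse (real (Suc (r k))) \<le> \<pi> (r k) $ i $ j"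
      by (simp add: eventually_all_finite)
    then obtain k where "\<forall>i j. 0 < P $ i $ j \<longrightarrow> inverse (real (Suc (r k))) \<le> \<pi> (r k) $ i $ j"
      using eventually_happens trivial_limit_sequentially by blast
    then have "good (inverse (real (Suc (r k)))) (\<pi> (r k))"
      unfolding good_def using Ppos marg by blast
    then show False using bad by blast
  qed
  then show ?thesis using that unfolding good_def by blast
qed

text \<open>From the first iteration on, one of the two marginals is exact, and the next half-step
  corrects the other one.\<close>

lemma sinkhorn_ascent:
  fixes \<mu> f0 :: "real ^ 'm" and \<nu> g0 :: "real ^ 'n" and C :: "real ^ 'n ^ 'm"
  assumes \<tau>: "0 < \<tau>" and \<mu>: "\<mu> \<in> prob_simplex" "\<forall>i. 0 < \<mu> $ i"
    and \<nu>: "\<nu> \<in> prob_simplex" "\<forall>j. 0 < \<nu> $ j" and k: "1 \<le> k"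
  defines "f \<equiv> \<lambda>k. fst (sinkhorn C \<mu> \<nu> \<tau> f0 g0 k)" and "g \<equiv> \<lambda>k. snd (sinkhorn C \<mu> \<nu> \<tau> f0 g0 k)"
  defines "e \<equiv> \<lambda>k. marginal_error \<mu> \<nu> (gibbs C \<mu> \<nu> \<tau> (f k) (g k))"
  shows "e (Suc k) \<le> e k"
    and "f k \<bullet> \<mu> + g k \<bullet> \<nu> + \<tau> / 4 * (e k)\<^sup>2 \<le> f (Suc k) \<bullet> \<mu> + g (Suc k) \<bullet> \<nu>"
    and "(\<Sum>i\<in>UNIV. \<Sum>j\<in>UNIV. gibbs C \<mu> \<nu> \<tau> (f k) (g k) $ i $ j) = 1"
proof -
  have even_step: "f (Suc k) = f_soft C \<nu> \<tau> (g k) \<and> g (Suc k) = g k" if "even k" for k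
    using that by (simp add: f_def g_def split_def Let_def)
  have odd_step: "f (Suc k) = f k \<and> g (Suc k) = g_soft C \<mu> \<tau> (f k)" if "odd k" for k
    using that by (simp add: f_def g_def split_def Let_def)
  obtain l where l: "k = Suc l" using k by (cases k) auto
  have X: "X_marginal (gibbs C \<mu> \<nu> \<tau> (f k) (g k)) = \<mu>" if "odd k"
    using that even_step[of l] l by (simp add: X_marginal_f_soft[OF \<tau> \<nu>(2)])
  have Y: "Y_marginal (gibbs C \<mu> \<nu> \<tau> (f k) (g k)) = \<nu>" if "even k"
    using that odd_step[of l] l by (simp add: Y_marginal_g_soft[OF \<tau> \<mu>(2)])
  show "e (Suc k) \<le> e k"
    and "f k \<bullet> \<mu> + g k \<bullet> \<nu> + \<tau> / 4 * (e k)\<^sup>2 \<le> f (Suc k) \<bullet> \<mu> + g (Suc k) \<bullet> \<nu>"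
  proof (atomize(full), cases "even k")
    case True
    show "e (Suc k) \<le> e k \<and> f k \<bullet> \<mu> + g k \<bullet> \<nu> + \<tau> / 4 * (e k)\<^sup>2 \<le> f (Suc k) \<bullet> \<mu> + g (Suc k) \<bullet> \<nu>"
      using f_soft_step[OF \<tau> \<mu> \<nu> Y[OF True]] even_step[OF True] by (simp add: e_def)
  next
    case False
    show "e (Suc k) \<le> e k \<and> f k \<bullet> \<mu> + g k \<bullet> \<nu> + \<tau> / 4 * (e k)\<^sup>2 \<le> f (Suc k) \<bullet> \<mu> + g (Suc k) \<bullet> \<nu>"
      using g_soft_step[OF \<tau> \<mu> \<nu> X[OF False]] odd_step[OF False] by (simp add: e_def)
  qed
  show "(\<Sum>i\<in>UNIV. \<Sum>j\<in>UNIV. gibbs C \<mu> \<nu> \<tau> (f k) (g k) $ i $ j) = 1"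
  proof (cases "even k")
    case True
    then show ?thesis using sum_Y_marginal[of "gibbs C \<mu> \<nu> \<tau> (f k) (g k)"] Y \<nu>(1)
      by (simp add: prob_simplex_def)
  next
    case False
    then show ?thesis using sum_X_marginal[of "gibbs C \<mu> \<nu> \<tau> (f k) (g k)"] X \<mu>(1)
      by (simp add: prob_simplex_def)
  qed
qed

text \<open>For any coupling \<open>P\<close> the dual value is the integral of \<open>f + g\<close> against \<open>P\<close>. Two dual values
  can therefore be compared through the slacks on the support of \<open>P\<close>, in which the cost cancels.\<close>

lemma dual_gap_at_coupling:
  fixes f f' \<mu> :: "real ^ 'm" and g g' \<nu> :: "real ^ 'n"
  assumes P: "\<forall>i j. 0 \<le> P $ i $ j" "X_marginal P = \<mu>" "Y_marginal P = \<nu>" "\<mu> \<in> prob_simplex"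
    and lower: "\<And>i j. 0 < P $ i $ j \<Longrightarrow> a \<le> f $ i + g $ j - C $ i $ j"
    and upper: "\<And>i j. f' $ i + g' $ j - C $ i $ j \<le> b"
  shows "f' \<bullet> \<mu> + g' \<bullet> \<nu> \<le> f \<bullet> \<mu> + g \<bullet> \<nu> + (b - a)"
proof -
  have dual: "f \<bullet> \<mu> + g \<bullet> \<nu> = (\<Sum>i\<in>UNIV. \<Sum>j\<in>UNIV. P $ i $ j * (f $ i + g $ j))" for f g
  proof -
    have "f \<bullet> \<mu> = (\<Sum>i\<in>UNIV. \<Sum>j\<in>UNIV. P $ i $ j * f $ i)"
      by (simp add: inner_vec_def X_marginal_def sum_distrib_left mult.commute flip: P(2))
    moreover have "g \<bullet> \<nu> = (\<Sum>i\<in>UNIV. \<Sum>j\<in>UNIV. P $ i $ j * g $ j)"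
      by (subst sum.swap) (simp add: inner_vec_def Y_marginal_def sum_distrib_left mult.commute flip: P(3))
    ultimately show ?thesis by (simp add: distrib_left sum.distrib)
  qed
  have "(\<Sum>i\<in>UNIV. \<Sum>j\<in>UNIV. P $ i $ j) = 1"
    using P(2,4) sum_X_marginal[of P] by (simp add: prob_simplex_def)
  then have "f \<bullet> \<mu> + g \<bullet> \<nu> + (b - a) = (\<Sum>i\<in>UNIV. \<Sum>j\<in>UNIV. P $ i $ j * (f $ i + g $ j + (b - a)))"
    by (simp add: dual[of f g] distrib_left sum.distrib flip: sum_distrib_right)
  moreover have "f' \<bullet> \<mu> + g' \<bullet> \<nu> \<le> (\<Sum>i\<in>UNIV. \<Sum>j\<in>UNIV. P $ i $ j * (f $ i + g $ j + (b - a)))"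
    unfolding dual[of f' g']
  proof (intro sum_mono)
    fix i j
    show "P $ i $ j * (f' $ i + g' $ j) \<le> P $ i $ j * (f $ i + g $ j + (b - a))"
    proof (cases "0 < P $ i $ j")
      case True
      then show ?thesis using lower[OF True] upper[of i j] by (intro mult_left_mono) auto
    next
      case False
      then show ?thesis using P(1)[rule_format, of i j] by simp
    qed
  qed
  ultimately show ?thesis by simp
qed

lemma gibbs_exponent:
  assumes "0 < \<tau>" "\<forall>i. 0 < \<mu> $ i" "\<forall>j. 0 < \<nu> $ j"
  shows "f $ i + g $ j - C $ i $ j = \<tau> * (ln (gibbs C \<mu> \<nu> \<tau> f g $ i $ j) + ln (1 / (\<mu> $ i * \<nu> $ j)))"
proof -
  have "\<mu> $ i * \<nu> $ j > 0" using assms by simp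
  then have "ln (gibbs C \<mu> \<nu> \<tau> f g $ i $ j) = (- C $ i $ j + f $ i + g $ j) / \<tau> + ln (\<mu> $ i * \<nu> $ j)"
    by (simp add: gibbs_def mult.assoc ln_mult_pos)
  then show ?thesis using assms(1) \<open>\<mu> $ i * \<nu> $ j > 0\<close> by (simp add: ln_div)
qed

text \<open>A soft transform is arbitrary only up to an additive constant: the oscillation of
  \<open>f\<close> is controlled by that of the cost, uniformly in \<open>g0\<close>. This makes the later time bound
  independent of the starting point.\<close>

lemma soft_transforms_slack:
  fixes \<mu> :: "real ^ 'm" and \<nu> g0 :: "real ^ 'n" and C :: "real ^ 'n ^ 'm"
  assumes \<tau>: "0 < \<tau>" and \<mu>: "\<mu> \<in> prob_simplex" "\<forall>i. 0 < \<mu> $ i" and \<nu>: "\<forall>j. 0 < \<nu> $ j"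
    and c: "\<And>i j. \<bar>C $ i $ j\<bar> \<le> c"
  defines "f \<equiv> f_soft C \<nu> \<tau> g0"
  shows "- 4 * c \<le> f $ i + g_soft C \<mu> \<tau> f $ j - C $ i $ j"
proof -
  have osc: "f $ i' \<le> f $ i + 2 * c" for i'
  proof -
    define Z where "Z = (\<lambda>i. \<Sum>j\<in>UNIV. exp ((- C $ i $ j + g0 $ j) / \<tau>) * \<nu> $ j)"
    have Zpos: "0 < Z i" for i unfolding Z_def using \<nu> by (intro sum_pos) auto
    have "Z i \<le> (\<Sum>j\<in>UNIV. exp (2 * c / \<tau>) * (exp ((- C $ i' $ j + g0 $ j) / \<tau>) * \<nu> $ j))"
      unfolding Z_def
    proof (intro sum_mono)
      fix j
      have "(- C $ i $ j + g0 $ j) / \<tau> \<le> (2 * c + (- C $ i' $ j + g0 $ j)) / \<tau>"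
        using c[of i j] c[of i' j] \<tau> by (intro divide_right_mono) auto
      then have "exp ((- C $ i $ j + g0 $ j) / \<tau>) \<le> exp (2 * c / \<tau>) * exp ((- C $ i' $ j + g0 $ j) / \<tau>)"
        by (simp add: add_divide_distrib diff_divide_distrib flip: exp_add)
      then show "exp ((- C $ i $ j + g0 $ j) / \<tau>) * \<nu> $ j
          \<le> exp (2 * c / \<tau>) * (exp ((- C $ i' $ j + g0 $ j) / \<tau>) * \<nu> $ j)"
        using \<nu>[rule_format, of j] by (simp add: mult_right_mono flip: mult.assoc)
    qed
    then have "Z i \<le> exp (2 * c / \<tau>) * Z i'" by (simp add: Z_def sum_distrib_left)
    then have "ln (Z i) \<le> ln (exp (2 * c / \<tau>) * Z i')" using Zpos by (simp add: ln_le_cancel_iff)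
    also have "\<dots> = 2 * c / \<tau> + ln (Z i')" using Zpos by (simp add: ln_mult_pos)
    finally have "\<tau> * ln (Z i) \<le> 2 * c + \<tau> * ln (Z i')"
      using \<tau> by (simp add: field_simps)
    then show ?thesis by (simp add: f_def f_soft_def Z_def)
  qed
  define Z where "Z = (\<Sum>i'\<in>UNIV. exp ((- C $ i' $ j + f $ i') / \<tau>) * \<mu> $ i')"
  have "0 < Z" unfolding Z_def using \<mu> by (intro sum_pos) auto
  have "Z \<le> (\<Sum>i'\<in>UNIV. exp ((f $ i + 3 * c) / \<tau>) * \<mu> $ i')"
    unfolding Z_def
  proof (intro sum_mono)
    fix i'
    have "(- C $ i' $ j + f $ i') / \<tau> \<le> (f $ i + 3 * c) / \<tau>"
      using osc[of i'] c[of i' j] \<tau> by (intro divide_right_mono) auto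
    then show "exp ((- C $ i' $ j + f $ i') / \<tau>) * \<mu> $ i' \<le> exp ((f $ i + 3 * c) / \<tau>) * \<mu> $ i'"
      using \<mu>(2)[rule_format, of i'] by (simp add: mult_right_mono)
  qed
  also have "\<dots> = exp ((f $ i + 3 * c) / \<tau>)"
    using \<mu>(1) by (simp add: prob_simplex_def flip: sum_distrib_left)
  finally have "ln Z \<le> (f $ i + 3 * c) / \<tau>" using \<open>0 < Z\<close> by (metis ln_exp ln_le_cancel_iff exp_gt_zero)
  then have "- (f $ i + 3 * c) \<le> g_soft C \<mu> \<tau> f $ j"
    using \<tau> by (simp add: g_soft_def Z_def field_simps)
  then show ?thesis using c[of i j] by (simp add: abs_le_iff)
qed

text \<open>In the proof, \<open>m\<close> iterations suffice to bring the error below the threshold \<open>\<eta>\<close>, because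
  the dual value has only \<open>s + 4 * c\<close> to gain; after that it has only \<open>K * \<tau>\<close> to gain. Here \<open>s\<close> bounds
  \<open>ln (1 / (\<mu> i * \<nu> j))\<close> and \<open>c\<close> bounds the cost.\<close>

lemma sinkhorn_marginal_error:
  fixes \<mu> :: "real ^ 'm" and \<nu> :: "real ^ 'n" and C :: "real ^ 'n ^ 'm"
  assumes \<mu>: "\<mu> \<in> prob_simplex" "\<forall>i. 0 < \<mu> $ i" and \<nu>: "\<nu> \<in> prob_simplex" "\<forall>j. 0 < \<nu> $ j"
  obtains T B where "0 \<le> B" "\<And>f0 g0 \<tau> k. 0 < \<tau> \<Longrightarrow> \<tau> < 1 \<Longrightarrow> T / \<tau> \<le> real k \<Longrightarrow>
    marginal_error \<mu> \<nu> (sinkhorn_primal C \<mu> \<nu> \<tau> f0 g0 k) \<le> B * sqrt \<tau>"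
proof -
  obtain \<eta> where \<eta>: "0 < \<eta>" "\<eta> \<le> 1" and near:
    "\<And>\<pi>. \<forall>i j. 0 \<le> \<pi> $ i $ j \<Longrightarrow> marginal_error \<mu> \<nu> \<pi> \<le> \<eta> \<Longrightarrow>
      \<exists>P. (\<forall>i j. 0 \<le> P $ i $ j) \<and> X_marginal P = \<mu> \<and> Y_marginal P = \<nu> \<and>
          (\<forall>i j. 0 < P $ i $ j \<longrightarrow> \<eta> \<le> \<pi> $ i $ j)"
    using near_couplings_dominate_a_coupling[of \<mu> \<nu>] by blast
  have le1: "\<mu> $ i \<le> 1" "\<nu> $ j \<le> 1" for i j
  proof -
    have "\<mu> $ i \<le> (\<Sum>i\<in>UNIV. \<mu> $ i)" "\<nu> $ j \<le> (\<Sum>j\<in>UNIV. \<nu> $ j)"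
      using \<mu>(2) \<nu>(2) by (auto intro!: member_le_sum intro: less_imp_le)
    then show "\<mu> $ i \<le> 1" "\<nu> $ j \<le> 1" using \<mu>(1) \<nu>(1) by (simp_all add: prob_simplex_def)
  qed
  define w where "w = (\<lambda>i j. ln (1 / (\<mu> $ i * \<nu> $ j)))"
  have w: "0 \<le> w i j" for i j
    using le1(1)[of i] le1(2)[of j] \<mu>(2) \<nu>(2) by (simp add: w_def less_imp_le mult_le_one)
  define s where "s = (\<Sum>i\<in>UNIV. \<Sum>j\<in>UNIV. w i j)"
  define c where "c = (\<Sum>i\<in>UNIV. \<Sum>j\<in>UNIV. \<bar>C $ i $ j\<bar>)"
  have entry_le: "h i j \<le> (\<Sum>i\<in>UNIV. \<Sum>j\<in>UNIV. h i j)" if "\<And>i j. 0 \<le> h i j" for h :: "'m \<Rightarrow> 'n \<Rightarrow> real" and i j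
  proof -
    have "h i j \<le> (\<Sum>j\<in>UNIV. h i j)" using that by (intro member_le_sum) auto
    also have "\<dots> \<le> (\<Sum>i\<in>UNIV. \<Sum>j\<in>UNIV. h i j)" using that by (intro member_le_sum) (auto intro: sum_nonneg)
    finally show ?thesis .
  qed
  have s: "w i j \<le> s" and c: "\<bar>C $ i $ j\<bar> \<le> c" for i j
    unfolding s_def c_def using w by (auto intro!: entry_le)
  have "0 \<le> s" "0 \<le> c" unfolding s_def c_def using w by (auto intro!: sum_nonneg)
  define K where "K = s - ln \<eta> + 1"
  define N where "N = 4 * (s + 4 * c) / \<eta>\<^sup>2"
  have "0 \<le> N" using \<open>0 \<le> s\<close> \<open>0 \<le> c\<close> by (simp add: N_def)
  have "0 < K" using \<open>0 \<le> s\<close> \<eta> ln_le_zero_iff[of \<eta>] by (simp add: K_def del: ln_le_zero_iff)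
  show ?thesis
  proof (rule that[of "2 * sqrt K" "N + 5"])
    show "0 \<le> 2 * sqrt K" using \<open>0 < K\<close> by simp
  next
    fix f0 g0 \<tau> k
    assume \<tau>: "0 < \<tau>" "\<tau> < (1::real)" and k: "(N + 5) / \<tau> \<le> real k"
    define f g where "f = (\<lambda>k. fst (sinkhorn C \<mu> \<nu> \<tau> f0 g0 k))" and "g = (\<lambda>k. snd (sinkhorn C \<mu> \<nu> \<tau> f0 g0 k))"
    define \<pi> where "\<pi> = (\<lambda>k. gibbs C \<mu> \<nu> \<tau> (f k) (g k))"
    define e D where "e = (\<lambda>k. marginal_error \<mu> \<nu> (\<pi> k))" and "D = (\<lambda>k. f k \<bullet> \<mu> + g k \<bullet> \<nu>)"
    have facts: "e (Suc k) \<le> e k" "D k + \<tau> / 4 * (e k)\<^sup>2 \<le> D (Suc k)"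
      "(\<Sum>i\<in>UNIV. \<Sum>j\<in>UNIV. \<pi> k $ i $ j) = 1" if "1 \<le> k" for k
      unfolding e_def D_def \<pi>_def f_def g_def by (rule sinkhorn_ascent[OF \<tau>(1) \<mu> \<nu> that])+
    have \<pi>pos: "0 < \<pi> k $ i $ j" for k i j unfolding \<pi>_def by (rule gibbs_pos[OF \<mu>(2) \<nu>(2)])
    have exponent: "f k $ i + g k $ j - C $ i $ j = \<tau> * (ln (\<pi> k $ i $ j) + w i j)" for k i j
      unfolding \<pi>_def w_def by (rule gibbs_exponent[OF \<tau>(1) \<mu>(2) \<nu>(2)])
    have upper: "f k $ i + g k $ j - C $ i $ j \<le> \<tau> * s" if "1 \<le> k" for k i j
    proof -
      \<comment> \<open>The plan has total mass \<open>1\<close>, so the logarithm of each entry is nonpositive.\<close>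
      have "\<pi> k $ i $ j \<le> 1"
        using entry_le[of "\<lambda>i j. \<pi> k $ i $ j"] \<pi>pos facts(3)[OF that] by (simp add: less_imp_le)
      then have "ln (\<pi> k $ i $ j) + w i j \<le> s" using \<pi>pos s[of i j] by (smt (verit) ln_le_zero_iff)
      then show ?thesis unfolding exponent using \<tau> by simp
    qed
    have e0: "0 \<le> e k" for k by (simp add: e_def marginal_error_def l1_norm_nonneg)
    have decr: "e (a + n) \<le> e a" if "1 \<le> a" for a n
    proof (induction n)
      case (Suc n)
      then show ?case using facts(1)[of "a + n"] that by simp
    qed simp
    have ascent: "D a + real n * (\<tau> / 4 * (e (a + n))\<^sup>2) \<le> D (a + n)" if "1 \<le> a" for a n
    proof -
      define q where "q = \<tau> / 4 * (e (a + n))\<^sup>2"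
      have "D a + real i * q \<le> D (a + i)" if "i \<le> n" for i
        using that
      proof (induction i)
        case (Suc i)
        have "e (a + n) \<le> e (a + i)" using decr[of "a + i" "n - i"] \<open>1 \<le> a\<close> Suc.prems by simp
        then have "q \<le> \<tau> / 4 * (e (a + i))\<^sup>2"
          unfolding q_def using \<tau> e0 by (intro mult_left_mono power_mono) auto
        moreover have "D a + real i * q \<le> D (a + i)" using Suc by simp
        moreover have "real (Suc i) * q = real i * q + q" by (simp add: distrib_right)
        ultimately show ?case using facts(2)[of "a + i"] \<open>1 \<le> a\<close> by simp
      qed simp
      then show ?thesis by (simp add: q_def)
    qed
    define m where "m = nat \<lceil>N / \<tau>\<rceil> + 1"
    have m: "N / \<tau> < real m" "real m \<le> N / \<tau> + 2"
      using \<open>0 \<le> N\<close> \<tau> unfolding m_def by (auto simp: of_nat_nat) linarith+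
    \<comment> \<open>The product coupling has full support, so the slack bound after two iterations applies.\<close>
    have D2: "D (2 + n) \<le> D 2 + (\<tau> * s - (- 4 * c))" for n
      unfolding D_def
    proof (rule dual_gap_at_coupling)
      let ?P = "\<chi> i j. \<mu> $ i * \<nu> $ j"
      show "\<forall>i j. 0 \<le> ?P $ i $ j" using \<mu> \<nu> by (simp add: less_imp_le)
      show "X_marginal ?P = \<mu>" "Y_marginal ?P = \<nu>"
        using \<mu> \<nu> by (simp_all add: vec_eq_iff X_marginal_def Y_marginal_def prob_simplex_def
            flip: sum_distrib_left sum_distrib_right)
      show "- 4 * c \<le> f 2 $ i + g 2 $ j - C $ i $ j" for i j
      proof -
        have "f 2 = f_soft C \<nu> \<tau> g0" "g 2 = g_soft C \<mu> \<tau> (f 2)"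
          by (simp_all add: f_def g_def numeral_2_eq_2)
        then show ?thesis using soft_transforms_slack[OF \<tau>(1) \<mu> \<nu>(2) c, of g0 i j] by simp
      qed
      show "f (2 + n) $ i + g (2 + n) $ j - C $ i $ j \<le> \<tau> * s" for i j by (rule upper) simp
    qed (rule \<mu>)
    have small: "e (2 + m) \<le> \<eta>"
    proof (rule ccontr)
      assume "\<not> ?thesis"
      then have "\<tau> / 4 * \<eta>\<^sup>2 \<le> \<tau> / 4 * (e (2 + m))\<^sup>2"
        using \<tau> \<eta> by (intro mult_left_mono power_mono) simp_all
      then have "real m * (\<tau> / 4 * \<eta>\<^sup>2) \<le> real m * (\<tau> / 4 * (e (2 + m))\<^sup>2)"
        by (rule mult_left_mono) simp
      then have "real m * (\<tau> / 4 * \<eta>\<^sup>2) \<le> \<tau> * s + 4 * c"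
        using ascent[of 2 m] D2[of m] by simp
      moreover have "\<tau> * s \<le> s" using \<tau> \<open>0 \<le> s\<close> by (simp add: mult_left_le_one_le)
      moreover have "N / \<tau> * (\<tau> / 4 * \<eta>\<^sup>2) < real m * (\<tau> / 4 * \<eta>\<^sup>2)"
        using m(1) \<tau> \<eta> by (intro mult_strict_right_mono) auto
      moreover have "N / \<tau> * (\<tau> / 4 * \<eta>\<^sup>2) = s + 4 * c" using \<tau> \<eta> by (simp add: N_def)
      ultimately show False by simp
    qed
    obtain P where P: "\<forall>i j. 0 \<le> P $ i $ j" "X_marginal P = \<mu>" "Y_marginal P = \<nu>"
      and supp: "\<And>i j. 0 < P $ i $ j \<Longrightarrow> \<eta> \<le> \<pi> (2 + m) $ i $ j"
      using near[of "\<pi> (2 + m)"] \<pi>pos small unfolding e_def by (meson less_imp_le)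
    have gap: "D (2 + m + n) \<le> D (2 + m) + (\<tau> * s - \<tau> * ln \<eta>)" for n
      unfolding D_def
    proof (rule dual_gap_at_coupling[OF P \<mu>(1)])
      show "\<tau> * ln \<eta> \<le> f (2 + m) $ i + g (2 + m) $ j - C $ i $ j" if "0 < P $ i $ j" for i j
      proof -
        have "ln \<eta> \<le> ln (\<pi> (2 + m) $ i $ j)" using supp[OF that] \<eta>(1) by (simp add: \<pi>pos)
        then show ?thesis unfolding exponent using w[of i j] \<tau> by (intro mult_left_mono) auto
      qed
      show "f (2 + m + n) $ i + g (2 + m + n) $ j - C $ i $ j \<le> \<tau> * s" for i j by (rule upper) simp
    qed
    \<comment> \<open>Of the \<open>(N + 5) / \<tau>\<close> iterations, \<open>2 + m\<close> reach the threshold and at least \<open>1 / \<tau>\<close> remain.\<close>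
    have "4 \<le> 4 / \<tau>" using \<tau> by (simp add: le_divide_eq)
    then have k': "real (2 + m) + 1 / \<tau> \<le> real k"
      using m(2) k by (simp add: add_divide_distrib)
    moreover have "0 < 1 / \<tau>" using \<tau> by simp
    ultimately have "2 + m \<le> k" by linarith
    then obtain n where n: "k = 2 + m + n" using le_Suc_ex by blast
    have "1 / \<tau> \<le> real n" using k' n by simp
    then have "1 / \<tau> * (\<tau> / 4 * (e k)\<^sup>2) \<le> real n * (\<tau> / 4 * (e k)\<^sup>2)"
      using \<tau> by (intro mult_right_mono) auto
    also have "\<dots> \<le> \<tau> * s - \<tau> * ln \<eta>" using ascent[of "2 + m" n] gap[of n] n by simp
    also have "\<dots> \<le> \<tau> * K" using \<tau> by (simp add: K_def algebra_simps)
    finally have gain: "1 / \<tau> * (\<tau> / 4 * (e k)\<^sup>2) \<le> \<tau> * K" .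
    have "(e k)\<^sup>2 \<le> (2 * sqrt K * sqrt \<tau>)\<^sup>2"
    proof -
      note gain
      moreover have "1 / \<tau> * (\<tau> / 4 * (e k)\<^sup>2) = (e k)\<^sup>2 / 4" using \<tau> by simp
      moreover have "(2 * sqrt K * sqrt \<tau>)\<^sup>2 = 4 * (\<tau> * K)"
        using \<tau> \<open>0 < K\<close> by (simp add: power_mult_distrib)
      ultimately show ?thesis by linarith
    qed
    then have "e k \<le> 2 * sqrt K * sqrt \<tau>"
      by (rule power2_le_imp_le) (use \<tau> \<open>0 < K\<close> in simp)
    moreover have "sinkhorn_primal C \<mu> \<nu> \<tau> f0 g0 k = \<pi> k"
      using n by (simp add: sinkhorn_primal_def \<pi>_def f_def g_def split_def Let_def del: sinkhorn.simps)
    ultimately show "marginal_error \<mu> \<nu> (sinkhorn_primal C \<mu> \<nu> \<tau> f0 g0 k) \<le> 2 * sqrt K * sqrt \<tau>"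
      by (simp only: e_def)
  qed
qed

section \<open>The projections that define the cold velocities\<close>

definition nonisolated :: "('m \<times> 'n) set \<Rightarrow> bool" where
  "nonisolated E \<longleftrightarrow> (\<forall>i. \<exists>j. (i, j) \<in> E) \<and> (\<forall>j. \<exists>i. (i, j) \<in> E)"

definition plans_onto :: "real ^ 'n \<Rightarrow> ('m \<times> 'n) set \<Rightarrow> (real ^ 'n ^ 'm) set" where
  "plans_onto \<nu> E = {Q \<in> edge_simplex E. Y_marginal Q = \<nu>}"

definition entropy_minimal :: "real ^ 'm \<Rightarrow> real ^ 'n \<Rightarrow> ('m \<times> 'n) set \<Rightarrow> real ^ 'n ^ 'm \<Rightarrow> bool" where
  "entropy_minimal \<mu> \<nu> E Q \<longleftrightarrow> Q \<in> plans_onto \<nu> E \<and>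
     (\<forall>Q'\<in>plans_onto \<nu> E. rel_entropy (X_marginal Q) \<mu> \<le> rel_entropy (X_marginal Q') \<mu>)"

lemma plans_onto_iff:
  assumes "\<nu> \<in> prob_simplex"
  shows "Q \<in> plans_onto \<nu> E \<longleftrightarrow>
    (\<forall>i j. 0 \<le> Q $ i $ j) \<and> (\<forall>i j. (i, j) \<notin> E \<longrightarrow> Q $ i $ j = 0) \<and> Y_marginal Q = \<nu>"
  using assms sum_Y_marginal[of Q] by (auto simp: plans_onto_def edge_simplex_def prob_simplex_def)

text \<open>At \<open>0\<close> the function is squeezed between the Hellinger bound \<open>2 * y - 2 * sqrt (y * m)\<close>
  and \<open>y^2 / m\<close>.\<close>

lemma continuous_on_entropy_term:
  fixes m :: real
  assumes "0 < m"
  shows "continuous_on {0..} (\<lambda>x. x * ln (x / m))"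
proof (rule continuous_on_eq_continuous_within[THEN iffD2], rule ballI)
  fix x :: real assume "x \<in> {0..}"
  show "continuous (at x within {0..}) (\<lambda>x. x * ln (x / m))"
  proof (cases "x = 0")
    case True
    have lower: "\<forall>\<^sub>F y in at 0 within {0..}. 2 * y - 2 * sqrt (y * m) \<le> y * ln (y / m)"
      unfolding eventually_at_filter
    proof (intro always_eventually allI impI)
      fix y :: real assume "y \<in> {0..}"
      then show "2 * y - 2 * sqrt (y * m) \<le> y * ln (y / m)"
        using entropy_term_ge_hellinger[of y m] assms
        by (simp add: power2_diff real_sqrt_mult)
    qed
    have upper: "\<forall>\<^sub>F y in at 0 within {0..}. y * ln (y / m) \<le> y * (y / m)"
      unfolding eventually_at_filter
    proof (intro always_eventually allI impI)
      fix y :: real assume "y \<in> {0..}" "y \<noteq> 0"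
      then have "ln (y / m) \<le> y / m" using ln_bound[of "y / m"] assms by simp
      then show "y * ln (y / m) \<le> y * (y / m)" using \<open>y \<in> {0..}\<close> by (intro mult_left_mono) auto
    qed
    have "((\<lambda>y. y * ln (y / m)) \<longlongrightarrow> 0) (at 0 within {0..})"
      by (rule tendsto_sandwich[OF lower upper]) (use assms in \<open>auto intro!: tendsto_eq_intros\<close>)
    then show ?thesis using True by (simp add: continuous_within)
  next
    case False
    then have "isCont (\<lambda>x. x * ln (x / m)) x" using assms by (intro continuous_intros) auto
    then show ?thesis by (rule continuous_at_imp_continuous_at_within)
  qed
qed

lemma entropy_minimal_exists:
  fixes \<mu> :: "real ^ 'm" and \<nu> :: "real ^ 'n"
  assumes \<mu>: "\<forall>i. 0 < \<mu> $ i" and \<nu>: "\<nu> \<in> prob_simplex" and E: "nonisolated E"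
  obtains Q where "entropy_minimal \<mu> \<nu> E Q"
proof -
  obtain h where h: "\<And>j. (h j, j) \<in> E" using E unfolding nonisolated_def by metis
  \<comment> \<open>Sending the whole mass of each column along a single edge gives an admissible plan.\<close>
  have "(\<chi> i j. if i = h j then \<nu> $ j else 0) \<in> plans_onto \<nu> E"
    using h \<nu> by (auto simp: plans_onto_iff prob_simplex_def Y_marginal_def vec_eq_iff)
  then have ne: "plans_onto \<nu> E \<noteq> {}" by blast
  have entry: "Q $ i $ j \<le> \<nu> $ j" if "Q \<in> plans_onto \<nu> E" for Q :: "real ^ 'n ^ 'm" and i j
  proof -
    have "Q $ i $ j \<le> Y_marginal Q $ j"
      using that \<nu> by (auto simp: plans_onto_iff Y_marginal_def intro!: member_le_sum)
    then show ?thesis using that by (simp add: plans_onto_def)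
  qed
  have "bounded (plans_onto \<nu> E)"
  proof (rule bounded_matrix_entries)
    fix Q i j assume "Q \<in> plans_onto \<nu> E"
    moreover have "\<nu> $ j \<le> (\<Sum>j\<in>UNIV. \<nu> $ j)"
      using \<nu> by (intro member_le_sum) (auto simp: prob_simplex_def)
    ultimately show "\<bar>Q $ i $ j\<bar> \<le> 1"
      using entry[of Q i j] \<nu> by (simp add: plans_onto_iff prob_simplex_def)
  qed
  moreover have "closed (plans_onto \<nu> E)"
  proof -
    have "plans_onto \<nu> E = {Q. (\<forall>i j. 0 \<le> Q $ i $ j) \<and> (\<forall>i j. (i, j) \<notin> E \<longrightarrow> Q $ i $ j = 0) \<and>
        (\<forall>j. (\<Sum>i\<in>UNIV. Q $ i $ j) = \<nu> $ j)}"
      using plans_onto_iff[OF \<nu>, of _ E] by (auto simp: Y_marginal_def vec_eq_iff)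
    then show ?thesis
      by (simp, intro closed_Collect_conj closed_Collect_all closed_Collect_imp closed_Collect_le
          closed_Collect_eq open_Collect_const continuous_intros)
  qed
  ultimately have "compact (plans_onto \<nu> E)" by (simp add: compact_eq_bounded_closed)
  moreover have "continuous_on (plans_onto \<nu> E) (\<lambda>Q. rel_entropy (X_marginal Q) \<mu>)"
  proof -
    have "continuous_on (plans_onto \<nu> E) (\<lambda>Q. X_marginal Q $ i * ln (X_marginal Q $ i / \<mu> $ i))" for i
    proof (rule continuous_on_compose2[OF continuous_on_entropy_term])
      show "continuous_on (plans_onto \<nu> E) (\<lambda>Q. X_marginal Q $ i)"
        unfolding X_marginal_def by (simp, intro continuous_intros)
      show "(\<lambda>Q. X_marginal Q $ i) ` plans_onto \<nu> E \<subseteq> {0..}"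
        using \<nu> by (auto simp: X_marginal_def plans_onto_iff intro!: sum_nonneg)
    qed (simp add: \<mu>)
    then show ?thesis unfolding rel_entropy_def by (rule continuous_on_sum)
  qed
  ultimately obtain Q where "Q \<in> plans_onto \<nu> E"
    "\<forall>Q'\<in>plans_onto \<nu> E. rel_entropy (X_marginal Q) \<mu> \<le> rel_entropy (X_marginal Q') \<mu>"
    using continuous_attains_inf ne by blast
  then show ?thesis using that by (simp add: entropy_minimal_def)
qed

text \<open>The tangent inequality for the convex function \<open>x * ln (x / m)\<close>, with the tangent taken at
  \<open>y > 0\<close>; as \<open>x = 0\<close> is included, the infinite slope at \<open>0\<close> causes no exception.\<close>

lemma entropy_term_tangent:
  fixes x y m :: real
  assumes "0 \<le> x" "0 < y" "0 < m"
  shows "y * ln (y / m) + (x - y) * (ln (y / m) + 1) \<le> x * ln (x / m)"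
proof (cases "x = 0")
  case False
  then have "ln (x / m) = ln (x / y) + ln (y / m)" using assms by (simp add: ln_div)
  then show ?thesis using entropy_term_ge_diff[OF assms(1,2)] by (simp add: algebra_simps)
qed (use assms in \<open>simp add: algebra_simps\<close>)

text \<open>The first-order condition of the minimization. If the density of the marginal were larger at
  \<open>i\<close> than at \<open>i'\<close>, moving a little mass inside column \<open>j\<close> from \<open>i\<close> to \<open>i'\<close> would lower the
  entropy. The tangents are taken at the perturbed marginal, which is positive even if the marginal
  vanishes at \<open>i'\<close>.\<close>

lemma entropy_minimal_ratio_le:
  fixes \<mu> :: "real ^ 'm" and \<nu> :: "real ^ 'n"
  assumes \<mu>: "\<forall>i. 0 < \<mu> $ i" and \<nu>: "\<nu> \<in> prob_simplex"
    and Q: "entropy_minimal \<mu> \<nu> E Q" and ij: "0 < Q $ i $ j" and i': "(i', j) \<in> E"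
  shows "X_marginal Q $ i / \<mu> $ i \<le> X_marginal Q $ i' / \<mu> $ i'"
proof (rule ccontr)
  assume contra: "\<not> ?thesis"
  then have ne: "i \<noteq> i'" by auto
  define x where "x = X_marginal Q"
  have plan: "Q \<in> plans_onto \<nu> E" using Q by (simp add: entropy_minimal_def)
  have Qpos: "0 \<le> Q $ a $ b" for a b using plan \<nu> by (simp add: plans_onto_iff)
  have x0: "0 \<le> x $ a" for a unfolding x_def X_marginal_def using Qpos by (simp add: sum_nonneg)
  have xi: "Q $ i $ j \<le> x $ i" unfolding x_def X_marginal_def using Qpos by (simp add: member_le_sum)
  define d where "d = x $ i / \<mu> $ i - x $ i' / \<mu> $ i'"
  define r where "r = 1 / \<mu> $ i + 1 / \<mu> $ i'"
  have "0 < d" using contra by (simp add: d_def x_def)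
  have "0 < r" using \<mu> by (simp add: r_def add_pos_pos)
  \<comment> \<open>Small enough to keep the plan nonnegative and the order of the two densities.\<close>
  define \<epsilon> where "\<epsilon> = min (Q $ i $ j / 2) (d / (2 * r))"
  have \<epsilon>: "0 < \<epsilon>" "\<epsilon> < Q $ i $ j" "\<epsilon> * r < d"
  proof -
    show "0 < \<epsilon>" "\<epsilon> < Q $ i $ j" using ij \<open>0 < d\<close> \<open>0 < r\<close> by (auto simp: \<epsilon>_def)
    have "\<epsilon> * r \<le> d / (2 * r) * r" using \<open>0 < r\<close> by (intro mult_right_mono) (auto simp: \<epsilon>_def)
    then show "\<epsilon> * r < d" using \<open>0 < r\<close> \<open>0 < d\<close> by simp
  qed
  define t where "t = (\<lambda>a. if a = i' then \<epsilon> else if a = i then - \<epsilon> else 0)"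
  have sum_t: "(\<Sum>a\<in>UNIV. t a) = 0"
  proof -
    have "(\<Sum>a\<in>UNIV. t a) = (\<Sum>a\<in>{i, i'}. t a)" by (rule sum.mono_neutral_right) (auto simp: t_def)
    then show ?thesis using ne by (simp add: t_def)
  qed
  define Q' :: "real ^ 'n ^ 'm" where "Q' = (\<chi> a b. Q $ a $ b + (if b = j then t a else 0))"
  have "Q' \<in> plans_onto \<nu> E"
    unfolding plans_onto_iff[OF \<nu>]
  proof (intro conjI allI impI)
    fix a b
    show "0 \<le> Q' $ a $ b" using Qpos[of a b] \<epsilon> by (auto simp: Q'_def t_def)
    assume "(a, b) \<notin> E"
    then have "Q $ a $ b = 0" using plan \<nu> by (simp add: plans_onto_iff)
    then show "Q' $ a $ b = 0" using \<open>(a, b) \<notin> E\<close> i' ij by (auto simp: Q'_def t_def)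
  next
    have "(\<Sum>a\<in>UNIV. if b = j then t a else 0) = 0" for b
      using sum_t by (cases "b = j") simp_all
    then have "Y_marginal Q' = Y_marginal Q"
      by (simp add: vec_eq_iff Y_marginal_def Q'_def sum.distrib)
    then show "Y_marginal Q' = \<nu>" using plan by (simp add: plans_onto_def)
  qed
  then have "rel_entropy x \<mu> \<le> rel_entropy (X_marginal Q') \<mu>"
    using Q by (simp add: entropy_minimal_def x_def)
  moreover have "X_marginal Q' $ a = x $ a + t a" for a
    by (simp add: X_marginal_def Q'_def x_def sum.distrib)
  ultimately have "0 \<le> (\<Sum>a\<in>UNIV. (x $ a + t a) * ln ((x $ a + t a) / \<mu> $ a) - x $ a * ln (x $ a / \<mu> $ a))"
    by (simp add: rel_entropy_def sum_subtractf)
  also have "\<dots> = (\<Sum>a\<in>{i, i'}. (x $ a + t a) * ln ((x $ a + t a) / \<mu> $ a) - x $ a * ln (x $ a / \<mu> $ a))"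
    by (rule sum.mono_neutral_right) (auto simp: t_def)
  also have "\<dots> \<le> (\<Sum>a\<in>{i, i'}. t a * (ln ((x $ a + t a) / \<mu> $ a) + 1))"
  proof (intro sum_mono)
    fix a assume "a \<in> {i, i'}"
    then have "0 < x $ a + t a" using xi \<epsilon> x0[of i'] by (auto simp: t_def)
    then show "(x $ a + t a) * ln ((x $ a + t a) / \<mu> $ a) - x $ a * ln (x $ a / \<mu> $ a)
        \<le> t a * (ln ((x $ a + t a) / \<mu> $ a) + 1)"
      using entropy_term_tangent[OF x0[of a], of "x $ a + t a" "\<mu> $ a"] \<mu> by simp
  qed
  also have "\<dots> = \<epsilon> * (ln ((x $ i' + \<epsilon>) / \<mu> $ i') - ln ((x $ i - \<epsilon>) / \<mu> $ i))"
    using ne by (simp add: t_def algebra_simps)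
  finally have "ln ((x $ i - \<epsilon>) / \<mu> $ i) \<le> ln ((x $ i' + \<epsilon>) / \<mu> $ i')"
    using \<epsilon>(1) by (simp add: zero_le_mult_iff)
  moreover have "0 < (x $ i - \<epsilon>) / \<mu> $ i" "0 < (x $ i' + \<epsilon>) / \<mu> $ i'"
    using xi \<epsilon> x0[of i'] \<mu> by (auto intro!: divide_pos_pos)
  ultimately have "(x $ i - \<epsilon>) / \<mu> $ i \<le> (x $ i' + \<epsilon>) / \<mu> $ i'" by (simp only: ln_le_cancel_iff)
  then have "d \<le> \<epsilon> * r" by (simp add: d_def r_def diff_divide_distrib add_divide_distrib algebra_simps)
  then show False using \<epsilon>(3) by simp
qed

text \<open>Integrate \<open>v i + w j\<close> against the plan.\<close>

lemma potentials_weak_duality: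
  fixes Q :: "real ^ 'n ^ 'm"
  assumes "\<nu> \<in> prob_simplex" "Q \<in> plans_onto \<nu> E"
    and vw: "\<And>i j. 0 < Q $ i $ j \<Longrightarrow> v $ i + w $ j \<le> 0"
  shows "w \<bullet> \<nu> \<le> - (v \<bullet> X_marginal Q)"
proof -
  have Q: "0 \<le> Q $ i $ j" "Y_marginal Q = \<nu>" for i j
    using assms(1,2) by (simp_all add: plans_onto_iff)
  have "v \<bullet> X_marginal Q = (\<Sum>i\<in>UNIV. \<Sum>j\<in>UNIV. Q $ i $ j * v $ i)"
    by (simp add: inner_vec_def X_marginal_def sum_distrib_left mult.commute)
  moreover have "w \<bullet> \<nu> = (\<Sum>i\<in>UNIV. \<Sum>j\<in>UNIV. Q $ i $ j * w $ j)"
    by (subst sum.swap) (simp add: inner_vec_def Y_marginal_def sum_distrib_left mult.commute flip: Q(2))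
  ultimately have "v \<bullet> X_marginal Q + w \<bullet> \<nu> = (\<Sum>i\<in>UNIV. \<Sum>j\<in>UNIV. Q $ i $ j * (v $ i + w $ j))"
    by (simp add: distrib_left sum.distrib)
  also have "\<dots> \<le> 0"
  proof (intro sum_nonpos)
    fix i j show "Q $ i $ j * (v $ i + w $ j) \<le> 0"
      using Q(1)[of i j] vw[of i j] by (cases "Q $ i $ j = 0") (auto simp: mult_le_0_iff)
  qed
  finally show ?thesis by simp
qed

lemma X_marginal_plan:
  assumes "\<nu> \<in> prob_simplex" "Q \<in> plans_onto \<nu> E"
  shows "X_marginal Q \<in> prob_simplex"
  using assms sum_X_marginal[of Q] by (auto simp: plans_onto_def edge_simplex_def prob_simplex_def X_marginal_def intro!: sum_nonneg)

text \<open>The first-order condition, written with potentials \<open>v\<close> and \<open>w\<close>, is sufficient. The entropy of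
  a competitor \<open>p\<close> with respect to \<open>\<mu>\<close> is its entropy with respect to \<open>x\<close>, the first marginal of \<open>Q\<close>, plus the linear term
  \<open>- (v \<bullet> p)\<close>. By weak duality the linear term is least at \<open>x\<close>, and the remaining entropy
  vanishes only at \<open>x\<close>, which also gives uniqueness.\<close>

lemma mu_star_eqI:
  fixes \<mu> v :: "real ^ 'm" and \<nu> w :: "real ^ 'n"
  assumes \<mu>: "\<forall>i. 0 < \<mu> $ i" and \<nu>: "\<nu> \<in> prob_simplex" and Q: "Q \<in> plans_onto \<nu> E"
    and E: "\<And>i j. (i, j) \<in> E \<Longrightarrow> v $ i + w $ j \<le> 0"
    and tight: "\<And>i j. 0 < Q $ i $ j \<Longrightarrow> v $ i + w $ j = 0"
    and X: "\<And>i. X_marginal Q $ i = \<mu> $ i * exp (- v $ i)"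
  shows "mu_star \<mu> \<nu> E = X_marginal Q"
proof -
  define x where "x = X_marginal Q"
  have xpos: "\<forall>i. 0 < x $ i" using \<mu> by (simp add: x_def X)
  have ent: "rel_entropy p \<mu> = rel_entropy p x - v \<bullet> p" if "\<forall>i. 0 \<le> p $ i" for p
  proof -
    have "p $ i * ln (p $ i / \<mu> $ i) = p $ i * ln (p $ i / x $ i) - v $ i * p $ i" for i
    proof (cases "p $ i = 0")
      case False
      then have "0 < p $ i" using that by (simp add: less_le)
      then have "ln (p $ i / x $ i) = ln (p $ i / \<mu> $ i) + v $ i"
        using \<mu>[rule_format, of i] by (simp add: x_def X ln_div ln_mult_pos)
      then show ?thesis by (simp add: algebra_simps)
    qed simp
    then show ?thesis by (simp add: rel_entropy_def inner_vec_def sum_subtractf)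
  qed
  have xs: "x \<in> prob_simplex" unfolding x_def by (rule X_marginal_plan[OF \<nu> Q])
  have "rel_entropy x x = 0" using xpos by (simp add: rel_entropy_def less_imp_neq[THEN not_sym])
  then have rx: "rel_entropy x \<mu> = - (v \<bullet> x)" using ent[of x] xpos by (simp add: less_imp_le)
  have "- (v \<bullet> x) \<le> w \<bullet> \<nu>"
  proof -
    have "(- w) \<bullet> \<nu> \<le> - ((- v) \<bullet> X_marginal Q)"
    proof (rule potentials_weak_duality[OF \<nu> Q])
      show "(- v) $ i + (- w) $ j \<le> 0" if "0 < Q $ i $ j" for i j using tight[OF that] by simp
    qed
    then show ?thesis by (simp add: x_def)
  qed
  have key: "rel_entropy x \<mu> + (l1_norm (p - x))\<^sup>2 / 4 \<le> rel_entropy p \<mu>"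
    if "Q' \<in> plans_onto \<nu> E" "p = X_marginal Q'" for p Q'
  proof -
    have ps: "p \<in> prob_simplex" unfolding that(2) by (rule X_marginal_plan[OF \<nu> that(1)])
    have "(i, j) \<in> E" if "0 < Q' $ i $ j" for i j
      using that \<open>Q' \<in> _\<close> by (force simp: plans_onto_iff[OF \<nu>])
    then have "w \<bullet> \<nu> \<le> - (v \<bullet> p)"
      unfolding that(2) using E by (intro potentials_weak_duality[OF \<nu> that(1)]) auto
    then have "rel_entropy x \<mu> \<le> - (v \<bullet> p)" using rx \<open>- (v \<bullet> x) \<le> w \<bullet> \<nu>\<close> by simp
    then show ?thesis
      using ent[of p] ps rel_entropy_ge_l1_norm[OF ps xs xpos] by (simp add: prob_simplex_def)
  qed
  define S where "S = {p. \<exists>Q\<in>edge_simplex E. X_marginal Q = p \<and> Y_marginal Q = \<nu>}"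
  have S: "p \<in> S \<longleftrightarrow> (\<exists>Q'\<in>plans_onto \<nu> E. p = X_marginal Q')" for p
    by (auto simp: S_def plans_onto_def)
  have "x \<in> S" using Q by (auto simp: S x_def)
  moreover have "rel_entropy x \<mu> \<le> rel_entropy p \<mu>" if "p \<in> S" for p
  proof -
    obtain Q' where "Q' \<in> plans_onto \<nu> E" "p = X_marginal Q'" using \<open>p \<in> S\<close> by (auto simp: S)
    then show ?thesis using key[of Q' p] zero_le_power2[of "l1_norm (p - x)"] by linarith
  qed
  ultimately have "is_arg_min (\<lambda>p. rel_entropy p \<mu>) (\<lambda>p. p \<in> S) x"
    by (auto simp: is_arg_min_def not_less)
  moreover have "p = x" if "is_arg_min (\<lambda>p. rel_entropy p \<mu>) (\<lambda>p. p \<in> S) p" for p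
  proof -
    have "p \<in> S" "rel_entropy p \<mu> \<le> rel_entropy x \<mu>"
      using that \<open>x \<in> S\<close> by (auto simp: is_arg_min_def not_less)
    then obtain Q' where "Q' \<in> plans_onto \<nu> E" "p = X_marginal Q'" by (auto simp: S)
    then have "(l1_norm (p - x))\<^sup>2 \<le> 0"
      using key[of Q' p] \<open>rel_entropy p \<mu> \<le> rel_entropy x \<mu>\<close> by linarith
    then show ?thesis by (simp add: l1_norm_def sum_nonneg_eq_0_iff vec_eq_iff)
  qed
  ultimately have "(SOME p. is_arg_min (\<lambda>p. rel_entropy p \<mu>) (\<lambda>p. p \<in> S) p) = x"
    by (intro some_equality)
  then show ?thesis by (simp add: mu_star_def arg_min_on_def arg_min_def S_def x_def)
qed

lemma edge_simplex_transpose: "transpose \<pi> \<in> edge_simplex (E\<inverse>) \<longleftrightarrow> \<pi> \<in> edge_simplex E"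
  using sum.swap[of "\<lambda>i j. \<pi> $ i $ j" UNIV UNIV] by (auto simp: edge_simplex_def transpose_def)

lemma nu_star_eq_mu_star: "nu_star \<mu> \<nu> E = mu_star \<nu> \<mu> (E\<inverse>)"
proof -
  have "(\<exists>P\<in>edge_simplex E. X_marginal P = \<mu> \<and> Y_marginal P = q) \<longleftrightarrow>
        (\<exists>Q\<in>edge_simplex (E\<inverse>). X_marginal Q = q \<and> Y_marginal Q = \<mu>)" for q
    by (metis X_marginal_transpose Y_marginal_transpose edge_simplex_transpose transpose_transpose)
  then show ?thesis by (simp add: nu_star_def mu_star_def)
qed

lemma plan_covers_columns:
  assumes "\<nu> \<in> prob_simplex" "\<forall>j. 0 < \<nu> $ j" "Q \<in> plans_onto \<nu> E"
  shows "\<exists>i. 0 < Q $ i $ j"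
proof (rule ccontr)
  assume "\<not> ?thesis"
  then have "Y_marginal Q $ j \<le> 0" by (auto simp: Y_marginal_def not_less intro!: sum_nonpos)
  moreover have "Y_marginal Q = \<nu>" using assms(3) by (simp add: plans_onto_def)
  ultimately show False using assms(2) by (simp add: not_le[symmetric])
qed

text \<open>The velocities are dual potentials for the minimization defining \<open>\<mu>\<^sup>*\<close>: edges of \<open>E\<close> do not
  become violated under the motion, and those carrying mass of an optimal plan \<open>Q\<close> stay tight. The
  vector \<open>v\<close> comes from an optimal \<open>Q\<close>, and \<open>w j = - v i\<close> for the rows \<open>i\<close> that \<open>Q\<close> uses in column
  \<open>j\<close>. That this \<open>w\<close> is the velocity defined through \<open>\<nu>\<^sup>*\<close> is seen by reweighting: the plan
  \<open>Q i j * exp (v i) = Q i j * exp (- w j)\<close> has first marginal \<open>\<mu>\<close>, and for the transposed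
  problem it satisfies the sufficient condition with the same potentials.\<close>

lemma star_potentials:
  fixes \<mu> :: "real ^ 'm" and \<nu> :: "real ^ 'n"
  assumes \<mu>: "\<mu> \<in> prob_simplex" "\<forall>i. 0 < \<mu> $ i" and \<nu>: "\<nu> \<in> prob_simplex" "\<forall>j. 0 < \<nu> $ j"
    and E: "nonisolated E"
  obtains Q where "entropy_minimal \<mu> \<nu> E Q" "mu_star \<mu> \<nu> E = X_marginal Q"
    "\<And>i. X_marginal Q $ i = \<mu> $ i * exp (- v_star \<mu> \<nu> E $ i)"
    "\<And>i j. (i, j) \<in> E \<Longrightarrow> v_star \<mu> \<nu> E $ i + w_star \<mu> \<nu> E $ j \<le> 0"
    "\<And>i j. 0 < Q $ i $ j \<Longrightarrow> v_star \<mu> \<nu> E $ i + w_star \<mu> \<nu> E $ j = 0"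
proof -
  obtain Q where min: "entropy_minimal \<mu> \<nu> E Q"
    using entropy_minimal_exists[OF \<mu>(2) \<nu>(1) E] .
  then have plan: "Q \<in> plans_onto \<nu> E" by (simp add: entropy_minimal_def)
  have Q0: "0 \<le> Q $ i $ j" "(i, j) \<notin> E \<Longrightarrow> Q $ i $ j = 0" "Y_marginal Q = \<nu>" for i j
    using plan \<nu>(1) by (simp_all add: plans_onto_iff)
  define x where "x = X_marginal Q"
  note ratio = entropy_minimal_ratio_le[OF \<mu>(2) \<nu>(1) min, folded x_def]
  obtain h where h: "\<And>j. 0 < Q $ (h j) $ j"
    using plan_covers_columns[OF \<nu> plan] by metis
  have xpos: "0 < x $ i" for i
  proof -
    obtain j where "(i, j) \<in> E" using E unfolding nonisolated_def by blast
    then have "x $ h j / \<mu> $ h j \<le> x $ i / \<mu> $ i" by (intro ratio[OF h])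
    moreover have "Q $ h j $ j \<le> x $ h j" unfolding x_def X_marginal_def using Q0 by (simp add: member_le_sum)
    ultimately have "0 < x $ i / \<mu> $ i" using h[of j] \<mu>(2) by (smt (verit) divide_pos_pos)
    then show ?thesis using \<mu>(2) by (auto simp: zero_less_divide_iff dest: order.asym)
  qed
  define v where "v = (\<chi> i. ln (\<mu> $ i / x $ i))"
  define w where "w = (\<chi> j. - v $ h j)"
  have v_mono: "v $ i' \<le> v $ i" if "0 < Q $ i $ j" "(i', j) \<in> E" for i i' j
  proof -
    have "\<mu> $ i' / x $ i' \<le> \<mu> $ i / x $ i"
      using ratio[OF that] \<mu>(2) xpos by (simp add: field_simps)
    then show ?thesis using \<mu>(2) xpos by (simp add: v_def)
  qed
  have vwE: "v $ i + w $ j \<le> 0" if "(i, j) \<in> E" for i j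
    using v_mono[OF h that] by (simp add: w_def)
  have supp: "(i, j) \<in> E" if "0 < Q $ i $ j" for i j using Q0(2)[of i j] that by force
  have vwQ: "v $ i + w $ j = 0" if "0 < Q $ i $ j" for i j
    using vwE[OF supp[OF that]] v_mono[OF that supp[OF h[of j]]] by (simp add: w_def)
  have X: "X_marginal Q $ i = \<mu> $ i * exp (- v $ i)" for i
    using \<mu>(2) xpos by (simp add: v_def x_def exp_minus less_imp_neq[THEN not_sym])
  have mu: "mu_star \<mu> \<nu> E = X_marginal Q"
    by (rule mu_star_eqI[OF \<mu>(2) \<nu>(1) plan vwE vwQ X])
  have v: "v_star \<mu> \<nu> E = v" by (simp add: v_star_def mu v_def x_def)
  define P :: "real ^ 'm ^ 'n" where "P = (\<chi> j i. Q $ i $ j * exp (v $ i))"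
  have YP: "Y_marginal P = \<mu>"
  proof -
    have "Y_marginal P $ i = X_marginal Q $ i * exp (v $ i)" for i
      by (simp add: Y_marginal_def X_marginal_def P_def sum_distrib_right)
    then show ?thesis by (simp add: vec_eq_iff X mult.assoc flip: exp_add)
  qed
  have XP: "X_marginal P $ j = \<nu> $ j * exp (- w $ j)" for j
  proof -
    have "Q $ i $ j * exp (v $ i) = Q $ i $ j * exp (- w $ j)" for i
    proof (cases "Q $ i $ j = 0")
      case False
      then have "v $ i = - w $ j" using vwQ[of i j] Q0(1)[of i j] by simp
      then show ?thesis by simp
    qed simp
    then have "X_marginal P $ j = (\<Sum>i\<in>UNIV. Q $ i $ j * exp (- w $ j))"
      by (simp only: X_marginal_def P_def vec_lambda_beta)
    then have "X_marginal P $ j = Y_marginal Q $ j * exp (- w $ j)"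
      by (simp add: Y_marginal_def sum_distrib_right)
    then show ?thesis by (simp add: Q0(3))
  qed
  have "mu_star \<nu> \<mu> (E\<inverse>) = X_marginal P"
  proof (rule mu_star_eqI[OF \<nu>(2) \<mu>(1) _ _ _ XP])
    show "P \<in> plans_onto \<mu> (E\<inverse>)"
      unfolding plans_onto_iff[OF \<mu>(1)] using Q0 YP by (auto simp: P_def)
    show "w $ j + v $ i \<le> 0" if "(j, i) \<in> E\<inverse>" for i j
      using vwE[of i j] that by simp
    show "w $ j + v $ i = 0" if "0 < P $ j $ i" for i j
      using vwQ[of i j] that by (simp add: P_def zero_less_mult_iff)
  qed
  then have w: "w_star \<mu> \<nu> E = w"
    using \<nu>(2) by (simp add: w_star_def nu_star_eq_mu_star vec_eq_iff XP ln_div less_imp_neq[THEN not_sym])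
  show ?thesis
    using that[OF min mu] X vwE vwQ unfolding v w by blast
qed

section \<open>The cold Sinkhorn dynamics has boundedly many phases\<close>

definition feasible_pair :: "real ^ 'n ^ 'm \<Rightarrow> real ^ 'm \<Rightarrow> real ^ 'n \<Rightarrow> bool" where
  "feasible_pair C f g \<longleftrightarrow> (\<forall>i j. f $ i + g $ j \<le> C $ i $ j) \<and> nonisolated (contact_edges C f g)"

text \<open>Column \<open>j\<close> has a contact edge because the minimum defining \<open>g j\<close> is attained. Row \<open>i\<close> has one
  because \<open>g \<ge> g0\<close>, so that an edge attaining the minimum in \<open>f i\<close> is tight.\<close>

lemma feasible_pair_hard:
  "feasible_pair C (f_hard C g0) (g_hard C (f_hard C g0))"
proof -
  define f g where "f = f_hard C g0" and "g = g_hard C f"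
  have f_le: "f $ i \<le> C $ i $ j - g0 $ j" for i j
    unfolding f_def f_hard_def by simp
  have f_attained: "\<exists>j. f $ i = C $ i $ j - g0 $ j" for i
  proof -
    have "(MIN j. C $ i $ j - g0 $ j) \<in> range (\<lambda>j. C $ i $ j - g0 $ j)" by (rule Min_in) auto
    then show ?thesis unfolding f_def f_hard_def vec_lambda_beta by blast
  qed
  have g_le: "g $ j \<le> C $ i $ j - f $ i" for i j
    unfolding g_def g_hard_def by simp
  have g_attained: "\<exists>i. g $ j = C $ i $ j - f $ i" for j
  proof -
    have "(MIN i. C $ i $ j - f $ i) \<in> range (\<lambda>i. C $ i $ j - f $ i)" by (rule Min_in) auto
    then show ?thesis unfolding g_def g_hard_def vec_lambda_beta by blast
  qed
  have "\<exists>j. f $ i + g $ j - C $ i $ j = 0" for i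
  proof -
    obtain j where "f $ i = C $ i $ j - g0 $ j" using f_attained by blast
    moreover have "g0 $ j \<le> g $ j"
    proof -
      obtain i' where "g $ j = C $ i' $ j - f $ i'" using g_attained by blast
      then show ?thesis using f_le[of i' j] by simp
    qed
    ultimately show ?thesis using g_le[of j i] by (intro exI[of _ j]) simp
  qed
  moreover have "\<exists>i. f $ i + g $ j - C $ i $ j = 0" for j
  proof -
    obtain i where "g $ j = C $ i $ j - f $ i" using g_attained by blast
    then show ?thesis by (intro exI[of _ i]) simp
  qed
  moreover have "f $ i + g $ j \<le> C $ i $ j" for i j
    using g_le[of j i] by simp
  ultimately have "feasible_pair C f g"
    by (simp add: feasible_pair_def nonisolated_def contact_edges_def)
  then show ?thesis by (simp add: f_def g_def)
qed

lemma zero_le_SUP_ereal_iff: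
  assumes "finite A"
  shows "0 \<le> (SUP a\<in>A. ereal (h a)) \<longleftrightarrow> (\<exists>a\<in>A. 0 \<le> h a)"
proof
  assume "\<exists>a\<in>A. 0 \<le> h a"
  then show "0 \<le> (SUP a\<in>A. ereal (h a))" by (auto intro: SUP_upper2)
next
  assume sup: "0 \<le> (SUP a\<in>A. ereal (h a))"
  show "\<exists>a\<in>A. 0 \<le> h a"
  proof (rule ccontr)
    assume "\<not> ?thesis"
    then have neg: "h a < 0" if "a \<in> A" for a using that by force
    \<comment> \<open>The supremum of the empty family is \<open>-\<infinity>\<close>; otherwise it is the maximum, which is negative.\<close>
    show False
    proof (cases "A = {}")
      case False
      have "(SUP a\<in>A. ereal (h a)) \<le> ereal (Max (h ` A))"
        using assms by (intro SUP_least) simp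
      moreover have "Max (h ` A) < 0" using assms False neg by simp
      then have "ereal (Max (h ` A)) < 0" by simp
      ultimately show False using sup by (meson le_less_trans not_le)
    qed (use sup in \<open>simp add: bot_ereal_def\<close>)
  qed
qed

text \<open>The set of times at which some edge outside \<open>E\<close> is no longer slack is closed, so a finite
  phase end belongs to it.\<close>

lemma phase_end_attained:
  fixes \<mu> f :: "real ^ 'm" and \<nu> g :: "real ^ 'n" and C :: "real ^ 'n ^ 'm"
  defines "E \<equiv> contact_edges C f g"
  defines "v \<equiv> v_star \<mu> \<nu> E" and "w \<equiv> w_star \<mu> \<nu> E"
  assumes fin: "phase_end C \<mu> \<nu> t f g < \<infinity>"
  defines "slack \<equiv> \<lambda>s i j. f $ i + g $ j + (s - t) * (v $ i + w $ j) - C $ i $ j"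
  obtains s where "phase_end C \<mu> \<nu> t f g = ereal s" "t \<le> s"
    "\<exists>i j. (i, j) \<notin> E \<and> 0 \<le> slack s i j"
    "\<And>r i j. t \<le> r \<Longrightarrow> r < s \<Longrightarrow> (i, j) \<notin> E \<Longrightarrow> slack r i j < 0"
proof -
  define S where "S = (\<Union>(i, j)\<in>- E. {s. t \<le> s \<and> 0 \<le> slack s i j})"
  have S: "s \<in> S \<longleftrightarrow> t \<le> s \<and> (\<exists>i j. (i, j) \<notin> E \<and> 0 \<le> slack s i j)" for s
    unfolding S_def by force
  have phase: "phase_end C \<mu> \<nu> t f g = Inf (ereal ` S)"
  proof -
    have "0 \<le> (SUP (i, j)\<in>- E. ereal (slack s i j)) \<longleftrightarrow> (\<exists>i j. (i, j) \<notin> E \<and> 0 \<le> slack s i j)" for s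
      using zero_le_SUP_ereal_iff[of "- E" "\<lambda>(i, j). slack s i j"] by (simp add: split_def Bex_def)
    then have "{ereal s | s. t \<le> s \<and> 0 \<le> (SUP (i, j)\<in>- E. ereal (slack s i j))} = ereal ` S"
      by (auto simp: S image_iff) blast
    then show ?thesis unfolding phase_end_def Let_def E_def[symmetric] v_def[symmetric] w_def[symmetric]
      by (simp add: slack_def)
  qed
  have "S \<noteq> {}" using fin by (auto simp: phase top_ereal_def)
  have bdd: "bdd_below S" by (rule bdd_belowI[of _ t]) (simp add: S)
  have "closed S"
    unfolding S_def slack_def
    by (intro closed_UN) (auto intro!: closed_Collect_conj closed_Collect_le continuous_intros)
  define s where "s = Inf S"
  have "s \<in> S" unfolding s_def by (rule closed_contains_Inf[OF \<open>S \<noteq> {}\<close> bdd \<open>closed S\<close>])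
  have least: "s \<le> r" if "r \<in> S" for r unfolding s_def by (rule cInf_lower[OF that bdd])
  have "Inf (ereal ` S) = ereal s"
    using \<open>s \<in> S\<close> least by (intro antisym Inf_lower Inf_greatest) auto
  then show ?thesis
    using that[of s] \<open>s \<in> S\<close> least unfolding phase S by (metis not_le)
qed

text \<open>At the end of a phase an optimal plan \<open>Q\<close> for the old edge set is still supported on the new one,
  and some edge \<open>(i0, j0)\<close> with \<open>v i0 + w j0 > 0\<close> has become tight. In column \<open>j0\<close> the plan uses a
  row \<open>i1\<close> with \<open>v i1 = - w j0 < v i0\<close>, which contradicts the first-order condition for the new edge
  set. So \<open>Q\<close> is admissible there without being optimal.\<close>

lemma phase_entropy_decreases:
  fixes \<mu> f :: "real ^ 'm" and \<nu> g :: "real ^ 'n" and C :: "real ^ 'n ^ 'm"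
  assumes \<mu>: "\<mu> \<in> prob_simplex" "\<forall>i. 0 < \<mu> $ i" and \<nu>: "\<nu> \<in> prob_simplex" "\<forall>j. 0 < \<nu> $ j"
    and feas: "feasible_pair C f g"
    and fin: "phase_end C \<mu> \<nu> t f g < \<infinity>"
  defines "E \<equiv> contact_edges C f g"
  defines "h \<equiv> real_of_ereal (phase_end C \<mu> \<nu> t f g) - t"
  defines "f' \<equiv> f + h *\<^sub>R v_star \<mu> \<nu> E" and "g' \<equiv> g + h *\<^sub>R w_star \<mu> \<nu> E"
  shows "feasible_pair C f' g'"
    and "rel_entropy (mu_star \<mu> \<nu> (contact_edges C f' g')) \<mu> < rel_entropy (mu_star \<mu> \<nu> E) \<mu>"
proof -
  define v w E' where "v = v_star \<mu> \<nu> E" and "w = w_star \<mu> \<nu> E" and "E' = contact_edges C f' g'"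
  have niE: "nonisolated E" using feas by (simp add: feasible_pair_def E_def)
  obtain Q where min: "entropy_minimal \<mu> \<nu> E Q" and mu: "mu_star \<mu> \<nu> E = X_marginal Q"
    and X: "\<And>i. X_marginal Q $ i = \<mu> $ i * exp (- v $ i)"
    and vwE: "\<And>i j. (i, j) \<in> E \<Longrightarrow> v $ i + w $ j \<le> 0"
    and vwQ: "\<And>i j. 0 < Q $ i $ j \<Longrightarrow> v $ i + w $ j = 0"
    using star_potentials[OF \<mu> \<nu> niE] unfolding v_def w_def by blast
  have plan: "Q \<in> plans_onto \<nu> E" using min by (simp add: entropy_minimal_def)
  have Q0: "0 \<le> Q $ i $ j" "0 < Q $ i $ j \<Longrightarrow> (i, j) \<in> E" "Y_marginal Q = \<nu>" for i j
    using plan by (force simp: plans_onto_iff[OF \<nu>(1)])+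
  obtain s where s: "phase_end C \<mu> \<nu> t f g = ereal s" "t \<le> s"
    and hit: "\<exists>i j. (i, j) \<notin> E \<and> 0 \<le> f $ i + g $ j + (s - t) * (v $ i + w $ j) - C $ i $ j"
    and before: "\<And>r i j. t \<le> r \<Longrightarrow> r < s \<Longrightarrow> (i, j) \<notin> E \<Longrightarrow>
      f $ i + g $ j + (r - t) * (v $ i + w $ j) - C $ i $ j < 0"
    using phase_end_attained[OF fin] unfolding v_def w_def E_def by metis
  have h: "h = s - t" "0 \<le> h" using s by (simp_all add: h_def)
  define a where "a = (\<lambda>i j. f $ i + g $ j - C $ i $ j)"
  have a': "f' $ i + g' $ j - C $ i $ j = a i j + h * (v $ i + w $ j)" for i j
    by (simp add: a_def f'_def g'_def v_def w_def algebra_simps)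
  have aE: "a i j = 0" if "(i, j) \<in> E" for i j using that by (simp add: E_def contact_edges_def a_def)
  have anE: "a i j < 0" if "(i, j) \<notin> E" for i j
    using that feas by (simp add: E_def contact_edges_def a_def feasible_pair_def less_le)
  have a'_le: "a i j + h * (v $ i + w $ j) \<le> 0" for i j
  proof (cases "(i, j) \<in> E")
    case True
    then show ?thesis using aE vwE h by (simp add: mult_nonneg_nonpos)
  next
    case False
    show ?thesis
    proof (rule ccontr)
      assume "\<not> ?thesis"
      then have pos: "0 < a i j + h * (v $ i + w $ j)" by simp
      then have k: "0 < v $ i + w $ j"
        using anE[OF False] h by (smt (verit) mult_nonneg_nonpos)
      \<comment> \<open>An edge that is violated at the end was tight at the earlier time \<open>r\<close>.\<close>
      define r where "r = t - a i j / (v $ i + w $ j)"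
      have "t \<le> r" using anE[OF False] k by (simp add: r_def divide_nonpos_pos)
      moreover have "- a i j / (v $ i + w $ j) < h" using pos by (subst pos_divide_less_eq[OF k]) simp
      then have "r < s" by (simp add: r_def h)
      moreover have "a i j + (r - t) * (v $ i + w $ j) = 0" using k by (simp add: r_def)
      ultimately show False using before[OF _ _ False, of r] by (simp add: a_def)
    qed
  qed
  have QE': "(i, j) \<in> E'" if "0 < Q $ i $ j" for i j
    using a'[of i j] aE[OF Q0(2)[OF that]] vwQ[OF that] by (simp add: E'_def contact_edges_def)
  have plan': "Q \<in> plans_onto \<nu> E'"
    unfolding plans_onto_iff[OF \<nu>(1)] using Q0(1,3) QE' by (metis order_le_less)
  have niE': "nonisolated E'"
    unfolding nonisolated_def
  proof (intro conjI allI)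
    show "\<exists>i. (i, j) \<in> E'" for j using plan_covers_columns[OF \<nu> plan] QE' by blast
    show "\<exists>j. (i, j) \<in> E'" for i
    proof (rule ccontr)
      assume "\<not> ?thesis"
      then have "X_marginal Q $ i \<le> 0"
        using QE' by (auto simp: X_marginal_def not_less intro!: sum_nonpos) (meson not_less)
      moreover have "0 < X_marginal Q $ i" using \<mu>(2) by (simp add: X)
      ultimately show False by simp
    qed
  qed
  show "feasible_pair C f' g'"
    using a'_le niE' by (simp add: feasible_pair_def E'_def flip: a')
  obtain i0 j0 where new: "(i0, j0) \<notin> E" "0 \<le> a i0 j0 + h * (v $ i0 + w $ j0)"
    using hit by (auto simp: a_def h algebra_simps)
  then have newE': "(i0, j0) \<in> E'" using a'_le[of i0 j0] a'[of i0 j0] by (simp add: E'_def contact_edges_def)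
  have "0 < v $ i0 + w $ j0" using new anE[OF new(1)] h by (smt (verit) mult_nonneg_nonpos)
  have "\<not> entropy_minimal \<mu> \<nu> E' Q"
  proof
    assume min': "entropy_minimal \<mu> \<nu> E' Q"
    obtain i1 where i1: "0 < Q $ i1 $ j0" using plan_covers_columns[OF \<nu> plan] by blast
    have "exp (- v $ i1) \<le> exp (- v $ i0)"
      using entropy_minimal_ratio_le[OF \<mu>(2) \<nu>(1) min' i1 newE'] \<mu>(2)
      by (simp add: X less_imp_neq[THEN not_sym])
    then show False using vwQ[OF i1] \<open>0 < v $ i0 + w $ j0\<close> by simp
  qed
  then obtain Q'' where Q'': "Q'' \<in> plans_onto \<nu> E'" "rel_entropy (X_marginal Q'') \<mu> < rel_entropy (X_marginal Q) \<mu>"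
    using plan' by (auto simp: entropy_minimal_def not_le)
  obtain Q' where "entropy_minimal \<mu> \<nu> E' Q'" "mu_star \<mu> \<nu> E' = X_marginal Q'"
    by (rule star_potentials[OF \<mu> \<nu> niE']) blast
  then show "rel_entropy (mu_star \<mu> \<nu> (contact_edges C f' g')) \<mu> < rel_entropy (mu_star \<mu> \<nu> E) \<mu>"
    using Q'' mu by (force simp: entropy_minimal_def E'_def)
qed

lemma cold_phase_strict_decrease:
  fixes \<mu> f0 :: "real ^ 'm" and \<nu> g0 :: "real ^ 'n"
  assumes \<mu>: "\<mu> \<in> prob_simplex" "\<forall>i. 0 < \<mu> $ i" and \<nu>: "\<nu> \<in> prob_simplex" "\<forall>j. 0 < \<nu> $ j"
    and feas: "feasible_pair C f0 g0"
    and some: "cold_phase C \<mu> \<nu> f0 g0 l = Some (t, f, g)"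
  shows "feasible_pair C f g \<and>
    (\<forall>k<l. \<exists>t' f' g'. cold_phase C \<mu> \<nu> f0 g0 k = Some (t', f', g') \<and>
       rel_entropy (mu_star \<mu> \<nu> (contact_edges C f g)) \<mu> < rel_entropy (mu_star \<mu> \<nu> (contact_edges C f' g')) \<mu>)"
  using some
proof (induction l arbitrary: t f g)
  case 0
  then show ?case using feas by simp
next
  case (Suc l)
  obtain t1 f1 g1 where l: "cold_phase C \<mu> \<nu> f0 g0 l = Some (t1, f1, g1)"
    and fin: "phase_end C \<mu> \<nu> t1 f1 g1 < \<infinity>"
    using Suc.prems by (auto simp: Let_def split: option.splits prod.splits if_splits)
  let ?h = "real_of_ereal (phase_end C \<mu> \<nu> t1 f1 g1) - t1" and ?E = "contact_edges C f1 g1"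
  have fg: "f = f1 + ?h *\<^sub>R v_star \<mu> \<nu> ?E" "g = g1 + ?h *\<^sub>R w_star \<mu> \<nu> ?E"
    using Suc.prems fin by (auto simp: l Let_def)
  note IH = Suc.IH[OF l]
  note step = phase_entropy_decreases[OF \<mu> \<nu> IH[THEN conjunct1] fin, folded fg]
  show ?case
  proof (intro conjI allI impI)
    fix k assume "k < Suc l"
    then consider "k = l" | "k < l" by linarith
    then show "\<exists>t' f' g'. cold_phase C \<mu> \<nu> f0 g0 k = Some (t', f', g') \<and>
       rel_entropy (mu_star \<mu> \<nu> (contact_edges C f g)) \<mu> < rel_entropy (mu_star \<mu> \<nu> (contact_edges C f' g')) \<mu>"
    proof cases
      case 1
      then show ?thesis using l step(2) by blast
    next
      case 2
      then show ?thesis using IH step(2) by (meson less_trans)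
    qed
  qed (rule step(1))
qed

text \<open>The entropy depends only on the edge set of the phase, so its strict decrease makes the edge
  sets of distinct phases distinct.\<close>

lemma cold_phases_le:
  fixes \<mu> f0 :: "real ^ 'm" and \<nu> g0 :: "real ^ 'n"
  assumes \<mu>: "\<mu> \<in> prob_simplex" "\<forall>i. 0 < \<mu> $ i" and \<nu>: "\<nu> \<in> prob_simplex" "\<forall>j. 0 < \<nu> $ j"
    and feas: "feasible_pair C f0 g0"
  shows "cold_phases C \<mu> \<nu> f0 g0 \<le> CARD(('m \<times> 'n) set)"
proof -
  define M where "M = Suc CARD(('m \<times> 'n) set)"
  have "cold_phase C \<mu> \<nu> f0 g0 M = None"
  proof (rule ccontr)
    assume "\<not> ?thesis"
    then obtain t f g where top: "cold_phase C \<mu> \<nu> f0 g0 M = Some (t, f, g)" by auto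
    \<comment> \<open>All phases up to \<open>M\<close> exist, so the default value is never taken.\<close>
    define E where "E = (\<lambda>k. case cold_phase C \<mu> \<nu> f0 g0 k of Some (t, f, g) \<Rightarrow> contact_edges C f g | None \<Rightarrow> {})"
    have "rel_entropy (mu_star \<mu> \<nu> (E l)) \<mu> < rel_entropy (mu_star \<mu> \<nu> (E k)) \<mu>" if "k < l" "l \<le> M" for k l
    proof -
      obtain t f g where l: "cold_phase C \<mu> \<nu> f0 g0 l = Some (t, f, g)"
        using cold_phase_strict_decrease[OF \<mu> \<nu> feas top] top \<open>l \<le> M\<close> by (metis le_neq_implies_less)
      obtain t' f' g' where "cold_phase C \<mu> \<nu> f0 g0 k = Some (t', f', g')"
        "rel_entropy (mu_star \<mu> \<nu> (contact_edges C f g)) \<mu> < rel_entropy (mu_star \<mu> \<nu> (contact_edges C f' g')) \<mu>"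
        using cold_phase_strict_decrease[OF \<mu> \<nu> feas l] \<open>k < l\<close> by blast
      then show ?thesis by (simp add: E_def l)
    qed
    then have "inj_on E {..M}"
      by (intro linorder_inj_onI') (metis atMost_iff less_irrefl)
    then have "card {..M} \<le> CARD(('m \<times> 'n) set)" by (rule card_inj_on_le) auto
    then show False by (simp only: card_atMost M_def)
  qed
  then show ?thesis unfolding cold_phases_def M_def by (rule Least_le)
qed

section \<open>The error bound\<close>

text \<open>The minimum with \<open>1\<close> makes the left-hand side decreasing in the exponent.\<close>

lemma min_1_powr_le_powr:
  fixes c x p :: real
  assumes "0 < c" "c \<le> x" "0 \<le> p" "p \<le> q"
  shows "min 1 c powr q \<le> x powr p"
proof -
  have "min 1 c powr q \<le> min 1 c powr p"
    using assms by (intro powr_mono') auto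
  also have "\<dots> \<le> x powr p" using assms by (intro powr_mono2) auto
  finally show ?thesis .
qed

theorem corollary4p1:
  fixes \<mu> :: "real ^ 'm" and \<nu> :: "real ^ 'n" and C :: "real ^ 'n ^ 'm"
  assumes "\<mu> \<in> prob_simplex" and "\<forall>i. 0 < \<mu> $ i"
    and "\<nu> \<in> prob_simplex" and "\<forall>j. 0 < \<nu> $ j"
  shows "\<exists>T::real. \<forall>\<tau>\<^sub>0<1. \<exists>B::real. \<forall>(f0 :: real ^ 'm) (g0 :: real ^ 'n) (\<tau>::real) (k::nat).
    0 < \<tau> \<and> \<tau> \<le> \<tau>\<^sub>0 \<and> real k \<ge> T / \<tau> \<longrightarrow>
      l1_norm (X_marginal (sinkhorn_primal C \<mu> \<nu> \<tau> f0 g0 k) - \<mu>)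
        + l1_norm (Y_marginal (sinkhorn_primal C \<mu> \<nu> \<tau> f0 g0 k) - \<nu>)
      \<le> B * sqrt \<tau> *
          ln (1 / \<tau>) powr (real (cold_phases C \<mu> \<nu> (f_hard C g0) (g_hard C (f_hard C g0))) + 1 / 2)"
proof -
  obtain T A where A: "0 \<le> A" and error: "\<And>f0 g0 \<tau> k. 0 < \<tau> \<Longrightarrow> \<tau> < 1 \<Longrightarrow> T / \<tau> \<le> real k \<Longrightarrow>
      marginal_error \<mu> \<nu> (sinkhorn_primal C \<mu> \<nu> \<tau> f0 g0 k) \<le> A * sqrt \<tau>"
    by (rule sinkhorn_marginal_error[OF assms, of C]) blast
  show ?thesis
  proof (rule exI[of _ T], intro allI impI)
    fix \<tau>\<^sub>0 :: real
    assume "\<tau>\<^sub>0 < 1"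
    define q where "q = real CARD(('m \<times> 'n) set) + 1 / 2"
    define \<gamma> where "\<gamma> = min 1 (ln (1 / \<tau>\<^sub>0)) powr q"
    show "\<exists>B::real. \<forall>(f0 :: real ^ 'm) (g0 :: real ^ 'n) (\<tau>::real) (k::nat).
      0 < \<tau> \<and> \<tau> \<le> \<tau>\<^sub>0 \<and> real k \<ge> T / \<tau> \<longrightarrow>
        l1_norm (X_marginal (sinkhorn_primal C \<mu> \<nu> \<tau> f0 g0 k) - \<mu>)
          + l1_norm (Y_marginal (sinkhorn_primal C \<mu> \<nu> \<tau> f0 g0 k) - \<nu>)
        \<le> B * sqrt \<tau> *
            ln (1 / \<tau>) powr (real (cold_phases C \<mu> \<nu> (f_hard C g0) (g_hard C (f_hard C g0))) + 1 / 2)"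
    proof (intro exI[of _ "A / \<gamma>"] allI impI, elim conjE)
      fix f0 :: "real ^ 'm" and g0 :: "real ^ 'n" and \<tau> :: real and k :: nat
      assume \<tau>: "0 < \<tau>" "\<tau> \<le> \<tau>\<^sub>0" and k: "real k \<ge> T / \<tau>"
      define p where "p = real (cold_phases C \<mu> \<nu> (f_hard C g0) (g_hard C (f_hard C g0))) + 1 / 2"
      have c: "0 < ln (1 / \<tau>\<^sub>0)" "ln (1 / \<tau>\<^sub>0) \<le> ln (1 / \<tau>)"
        using \<tau> \<open>\<tau>\<^sub>0 < 1\<close> by (auto simp: ln_div)
      then have "0 < \<gamma>" by (simp add: \<gamma>_def)
      have "p \<le> q"
        using cold_phases_le[OF assms feasible_pair_hard[of C g0]] by (simp add: p_def q_def)
      then have "\<gamma> \<le> ln (1 / \<tau>) powr p"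
        unfolding \<gamma>_def using c by (intro min_1_powr_le_powr) (auto simp: p_def)
      then have "A / \<gamma> * sqrt \<tau> * \<gamma> \<le> A / \<gamma> * sqrt \<tau> * ln (1 / \<tau>) powr p"
        using A \<open>0 < \<gamma>\<close> \<tau> by (intro mult_left_mono) auto
      moreover have "marginal_error \<mu> \<nu> (sinkhorn_primal C \<mu> \<nu> \<tau> f0 g0 k) \<le> A * sqrt \<tau>"
        using error[OF \<tau>(1) _ k] \<tau> \<open>\<tau>\<^sub>0 < 1\<close> by simp
      ultimately show "l1_norm (X_marginal (sinkhorn_primal C \<mu> \<nu> \<tau> f0 g0 k) - \<mu>)
          + l1_norm (Y_marginal (sinkhorn_primal C \<mu> \<nu> \<tau> f0 g0 k) - \<nu>)
        \<le> A / \<gamma> * sqrt \<tau> *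
            ln (1 / \<tau>) powr (real (cold_phases C \<mu> \<nu> (f_hard C g0) (g_hard C (f_hard C g0))) + 1 / 2)"
        using \<open>0 < \<gamma>\<close> by (simp add: marginal_error_def p_def)
    qed
  qed
qed

end
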